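(* Let $\varphi\in\mathrm{MI}$ and let $\mathcal{A}\subseteq\mathcal{P}^d_\varphi(\Omega)$ be a dictionary of atoms such that $\mathcal{M}(\mathcal{A})$ is identifiable. For each $i\in\{0,1\}$ let $\nu_i=\sum_{j_i=1}^{J_i}\lambda_{i,j_i}\mu_{i,j_i}\in\mathcal{M}(\mathcal{A})$ with $\mu_{i,j_i}\in\mathcal{A}$ and $\lambda_i=(\lambda_{i,1},\dots,\lambda_{i,J_i})\in\Delta^{J_i}$. Define $$\mathrm{MW}^d_{\mathcal{A},\varphi}(\nu_0,\nu_1):=\varphi^{-1}\Big(\inf_{\gamma\in\mathcal{M}\Pi(\mathcal{A})\cap\Pi(\nu_0,\nu_1)}\int_{\Omega\times\Omega}\varphi(d(x_0,x_1))\,d\gamma(x_0,x_1)\Big)\qquad(\mathrm{a})$$ and $$W_{\mathcal{A},\varphi}(\nu_0,\nu_1):=\varphi^{-1}\Big(\inf_{w\in\Pi(\lambda_0,\lambda_1)}\sum_{j_0=1}^{J_0}\sum_{j_1=1}^{J_1}w_{j_0,j_1}\,\varphi\big(\mathrm{W}^d_\varphi(\mu_{0,j_0},\mu_{1,j_1})\big)\Big).\qquad(\mathrm{b})$$ Then $\mathrm{MW}^d_{\mathcal{A},\varphi}(\nu_0,\nu_1)=W_{\mathcal{A},\varphi}(\nu_0,\nu_1)$. Moreover, the set of minimizers of the infimum in (a) is equal to the set of measures $\gamma$ which can be written as $$\gamma=\sum_{j_0=1}^{J_0}\sum_{j_1=1}^{J_1}w^\ast_{j_0,j_1}\gamma_{j_0,j_1},$$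 where $w^\ast=(w^\ast_{j_0,j_1})$ is a minimizer of the infimum in (b) and $\gamma_{j_0,j_1}\in\Gamma^d_\varphi(\mu_{0,j_0},\mu_{1,j_1})$ for all $j_0\in\{1,\dots,J_0\}$, $j_1\in\{1,\dots,J_1\}$.
   Context: $(\mathcal{X},d)$ is a Polish metric space, $\Omega\subseteq\mathcal{X}$ is a fixed Borel set (with the metric $d$ restricted to it), and $\mathcal{P}(\cdot)$ denotes the set of Borel probability measures. $\Delta^J=\{(\lambda_1,\dots,\lambda_J)\in[0,1]^J:\sum_j\lambda_j=1\}$. $\mathrm{MI}$ is the set of increasing bijections $\varphi:\mathbb{R}_{\ge0}\to\mathbb{R}_{\ge0}$ such that $F_\varphi(x_0,x_1):=\varphi(\varphi^{-1}(x_0)+\varphi^{-1}(x_1))$ is concave on $\mathbb{R}_{\ge0}^2$. $\mathcal{P}^d_\varphi(\Omega)=\{\mu\in\mathcal{P}(\Omega):\int_\Omega\varphi(d(x,y))\,d\mu(x)<+\infty\text{ for some }y\in\Omega\}$ (independent of the choice of $y$). For probability measures $\mu_0,\mu_1$, $\Pi(\mu_0,\mu_1)$ is the set of couplings (joint laws with marginals $\mu_0,\mu_1$), and $$\mathrm{W}^d_\varphi(\mu_0,\mu_1)=\varphi^{-1}\Big(\inf_{\gamma\in\Pi(\mu_0,\mu_1)}\int\varphi(d(x_0,x_1))\,d\gamma(x_0,x_1)\Big).$$ $\Gamma^d_\varphi(\mu_0,\mu_1)$ is the (nonempty) set of minimizers $\gamma$ of this infimum. A dictionary of atoms is a nonempty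 set $\mathcal{A}$ of probability measures; $\mathcal{M}(\mathcal{A})$ is the set of finite mixtures $\sum_{j=1}^J\lambda_j\mu_j$ with $J\ge1$, $\mu_j\in\mathcal{A}$, $(\lambda_j)_j\in\Delta^J$. $\Pi(\mathcal{A})=\bigcup_{\mu_0,\mu_1\in\mathcal{A}}\Pi(\mu_0,\mu_1)$ and $\mathcal{M}\Pi(\mathcal{A})=\mathcal{M}(\Pi(\mathcal{A}))\subseteq\mathcal{P}(\Omega\times\Omega)$ is the set of finite mixtures of elements of $\Pi(\mathcal{A})$. Identifiability of $\mathcal{M}(\mathcal{A})$: for any two mixtures $\nu_i=\sum_{j=1}^{J_i}\lambda_{i,j}\mu_{i,j}$ ($i=0,1$) with all $\lambda_{i,j}>0$ and, for each $i$, the atoms $\mu_{i,1},\dots,\mu_{i,J_i}\in\mathcal{A}$ pairwise distinct, one has $\nu_0=\nu_1$ if and only if $J_0=J_1$ and, after reordering indices, $\lambda_{0,j}=\lambda_{1,j}$ and $\mu_{0,j}=\mu_{1,j}$ for all $j$. For weight vectors, $\Pi(\lambda_0,\lambda_1)$ is the set of matrices $w=(w_{j_0,j_1})\in\mathbb{R}_{\ge0}^{J_0\times J_1}$ with $\sum_{j_1}w_{j_0,j_1}=\lambda_{0,j_0}$ for all $j_0$ and $\sum_{j_0}w_{j_0,j_1}=\lambda_{1,j_1}$ for all $j_1$. *)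

theory Defs
  imports "HOL-Probability.Probability"
begin

definition MI :: "(real \<Rightarrow> real) set" where
  "MI = {\<phi>. bij_betw \<phi> {0..} {0..} \<and> mono_on {0..} \<phi> \<and>
     concave_on ({0..} \<times> {0..})
       (\<lambda>(x0, x1). \<phi> (inv_into {0..} \<phi> x0 + inv_into {0..} \<phi> x1))}"

text \<open>Costs are nonnegative integrals, hence extended nonnegative reals.  A function on
  \<open>[0,\<infinity>)\<close> is extended to \<open>[0,\<infinity>]\<close> by \<open>\<infinity> \<mapsto> \<infinity>\<close>, as is usual for an increasing bijection,
  so that \<open>\<phi>\<close> and its inverse can be applied to such costs.\<close>

definition extend_top :: "(real \<Rightarrow> real) \<Rightarrow> ennreal \<Rightarrow> ennreal" where
  "extend_top f c = (if c = \<top> then \<top> else ennreal (f (enn2real c)))"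

abbreviation ext_inv :: "(real \<Rightarrow> real) \<Rightarrow> ennreal \<Rightarrow> ennreal" where
  "ext_inv \<phi> \<equiv> extend_top (inv_into {0..} \<phi>)"

abbreviation borel_on :: "'a::topological_space set \<Rightarrow> 'a measure" where
  "borel_on \<Omega> \<equiv> restrict_space borel \<Omega>"

definition prob_measures :: "'a measure \<Rightarrow> 'a measure set" where
  "prob_measures M = {\<mu>. prob_space \<mu> \<and> sets \<mu> = sets M}"

definition P_phi :: "(real \<Rightarrow> real) \<Rightarrow> 'a::metric_space set \<Rightarrow> 'a measure set" where
  "P_phi \<phi> \<Omega> = {\<mu> \<in> prob_measures (borel_on \<Omega>).
     \<exists>y\<in>\<Omega>. (\<integral>\<^sup>+ x. ennreal (\<phi> (dist x y)) \<partial>\<mu>) < \<infinity>}"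

definition couplings :: "'a measure \<Rightarrow> 'b measure \<Rightarrow> ('a \<times> 'b) measure set" where
  "couplings \<mu>0 \<mu>1 = {\<gamma> \<in> prob_measures (\<mu>0 \<Otimes>\<^sub>M \<mu>1).
     distr \<gamma> \<mu>0 fst = \<mu>0 \<and> distr \<gamma> \<mu>1 snd = \<mu>1}"

definition cost :: "(real \<Rightarrow> real) \<Rightarrow> ('a::metric_space \<times> 'a) measure \<Rightarrow> ennreal" where
  "cost \<phi> \<gamma> = (\<integral>\<^sup>+ (x0, x1). ennreal (\<phi> (dist x0 x1)) \<partial>\<gamma>)"

definition minimizers :: "('b \<Rightarrow> 'c::order) \<Rightarrow> 'b set \<Rightarrow> 'b set" where
  "minimizers f S = {x. is_arg_min f (\<lambda>y. y \<in> S) x}"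

definition W_phi ::
    "(real \<Rightarrow> real) \<Rightarrow> 'a::metric_space measure \<Rightarrow> 'a measure \<Rightarrow> ennreal" where
  "W_phi \<phi> \<mu>0 \<mu>1 = ext_inv \<phi> (INF \<gamma>\<in>couplings \<mu>0 \<mu>1. cost \<phi> \<gamma>)"

definition opt_couplings ::
    "(real \<Rightarrow> real) \<Rightarrow> 'a::metric_space measure \<Rightarrow> 'a measure \<Rightarrow> ('a \<times> 'a) measure set" where
  "opt_couplings \<phi> \<mu>0 \<mu>1 = minimizers (cost \<phi>) (couplings \<mu>0 \<mu>1)"

text \<open>The measure \<open>\<Sum>i\<in>I. l i * m i\<close> on the measurable space of \<open>M\<close>, for finite \<open>I\<close> and measures
  \<open>m i\<close> with the same measurable sets as \<open>M\<close>.\<close>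

definition weighted_sum ::
    "'a measure \<Rightarrow> 'i set \<Rightarrow> ('i \<Rightarrow> real) \<Rightarrow> ('i \<Rightarrow> 'a measure) \<Rightarrow> 'a measure" where
  "weighted_sum M I l m =
     measure_of (space M) (sets M) (\<lambda>B. \<Sum>i\<in>I. ennreal (l i) * emeasure (m i) B)"

lemma sets_weighted_sum [simp]: "sets (weighted_sum M I l m) = sets M"
  by (simp add: weighted_sum_def sets.sets_measure_of_eq)

lemma emeasure_weighted_sum:
  fixes M :: "'a measure"
  assumes fin: "finite I" and m: "\<And>i. i \<in> I \<Longrightarrow> sets (m i) = sets M" and B: "B \<in> sets M"
  shows "emeasure (weighted_sum M I l m) B = (\<Sum>i\<in>I. ennreal (l i) * emeasure (m i) B)"
proof (rule emeasure_measure_of[OF weighted_sum_def])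
  show "sets M \<subseteq> Pow (space M)" by (rule sets.space_closed)
  show "B \<in> sets (weighted_sum M I l m)" using B by simp
  show "positive (sets (weighted_sum M I l m)) (\<lambda>B. \<Sum>i\<in>I. ennreal (l i) * emeasure (m i) B)"
    by (simp add: positive_def)
  show "countably_additive (sets (weighted_sum M I l m))
          (\<lambda>B. \<Sum>i\<in>I. ennreal (l i) * emeasure (m i) B)"
  proof (rule countably_additiveI)
    fix F :: "nat \<Rightarrow> 'a set"
    assume F: "range F \<subseteq> sets (weighted_sum M I l m)" "disjoint_family F"
    have "(\<Sum>n. \<Sum>i\<in>I. ennreal (l i) * emeasure (m i) (F n)) =
          (\<Sum>i\<in>I. \<Sum>n. ennreal (l i) * emeasure (m i) (F n))"
      by (rule suminf_sum) simp
    also have "\<dots> = (\<Sum>i\<in>I. ennreal (l i) * emeasure (m i) (\<Union>n. F n))"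
    proof (rule sum.cong)
      fix i assume "i \<in> I"
      then have "range F \<subseteq> sets (m i)" using F m by simp
      then show "(\<Sum>n. ennreal (l i) * emeasure (m i) (F n)) =
          ennreal (l i) * emeasure (m i) (\<Union>n. F n)"
        using suminf_emeasure[of F "m i"] F(2) by simp
    qed simp
    finally show "(\<Sum>n. \<Sum>i\<in>I. ennreal (l i) * emeasure (m i) (F n)) =
      (\<Sum>i\<in>I. ennreal (l i) * emeasure (m i) (\<Union>(range F)))" .
  qed
qed

definition simplex_weights :: "nat \<Rightarrow> (nat \<Rightarrow> real) set" where
  "simplex_weights J = {l. (\<forall>j\<in>{1..J}. l j \<in> {0..1}) \<and> (\<Sum>j\<in>{1..J}. l j) = 1}"

abbreviation mixture ::
    "'a measure \<Rightarrow> nat \<Rightarrow> (nat \<Rightarrow> real) \<Rightarrow> (nat \<Rightarrow> 'a measure) \<Rightarrow> 'a measure" where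
  "mixture M J l m \<equiv> weighted_sum M {1..J} l m"

definition mixtures :: "'a measure \<Rightarrow> 'a measure set \<Rightarrow> 'a measure set" where
  "mixtures M A = {mixture M J l m | J l m.
     J \<ge> 1 \<and> (\<forall>j\<in>{1..J}. m j \<in> A) \<and> l \<in> simplex_weights J}"

definition identifiable :: "'a measure \<Rightarrow> 'a measure set \<Rightarrow> bool" where
  "identifiable M A \<longleftrightarrow>
     (\<forall>J0 J1 l0 l1 m0 m1.
        J0 \<ge> 1 \<and> l0 \<in> simplex_weights J0 \<and> (\<forall>j\<in>{1..J0}. l0 j > 0) \<and>
        m0 ` {1..J0} \<subseteq> A \<and> inj_on m0 {1..J0} \<and>
        J1 \<ge> 1 \<and> l1 \<in> simplex_weights J1 \<and> (\<forall>j\<in>{1..J1}. l1 j > 0) \<and>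
        m1 ` {1..J1} \<subseteq> A \<and> inj_on m1 {1..J1} \<longrightarrow>
        (mixture M J0 l0 m0 = mixture M J1 l1 m1 \<longleftrightarrow>
         J0 = J1 \<and> (\<exists>\<sigma>. bij_betw \<sigma> {1..J0} {1..J1} \<and>
            (\<forall>j\<in>{1..J0}. l0 j = l1 (\<sigma> j) \<and> m0 j = m1 (\<sigma> j)))))"

definition dict_couplings :: "'a measure set \<Rightarrow> ('a \<times> 'a) measure set" where
  "dict_couplings A = (\<Union>\<mu>0\<in>A. \<Union>\<mu>1\<in>A. couplings \<mu>0 \<mu>1)"

definition mix_couplings ::
    "'a::topological_space set \<Rightarrow> 'a measure set \<Rightarrow> 'a measure \<Rightarrow> 'a measure \<Rightarrow>
     ('a \<times> 'a) measure set" where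
  "mix_couplings \<Omega> A \<nu>0 \<nu>1 =
     mixtures (borel_on \<Omega> \<Otimes>\<^sub>M borel_on \<Omega>) (dict_couplings A) \<inter> couplings \<nu>0 \<nu>1"

definition MW ::
    "(real \<Rightarrow> real) \<Rightarrow> 'a::metric_space set \<Rightarrow> 'a measure set \<Rightarrow>
     'a measure \<Rightarrow> 'a measure \<Rightarrow> ennreal" where
  "MW \<phi> \<Omega> A \<nu>0 \<nu>1 = ext_inv \<phi> (INF \<gamma>\<in>mix_couplings \<Omega> A \<nu>0 \<nu>1. cost \<phi> \<gamma>)"

text \<open>Matrices and weight vectors are functions on \<open>nat\<close> of which only the values at the indices
  \<open>1..J\<close> matter; the other values are unconstrained.\<close>

definition weight_couplings ::
    "nat \<Rightarrow> nat \<Rightarrow> (nat \<Rightarrow> real) \<Rightarrow> (nat \<Rightarrow> real) \<Rightarrow> (nat \<Rightarrow> nat \<Rightarrow> real) set" where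
  "weight_couplings J0 J1 l0 l1 =
     {w. (\<forall>j0\<in>{1..J0}. \<forall>j1\<in>{1..J1}. w j0 j1 \<ge> 0) \<and>
         (\<forall>j0\<in>{1..J0}. (\<Sum>j1\<in>{1..J1}. w j0 j1) = l0 j0) \<and>
         (\<forall>j1\<in>{1..J1}. (\<Sum>j0\<in>{1..J0}. w j0 j1) = l1 j1)}"

definition discrete_cost ::
    "(real \<Rightarrow> real) \<Rightarrow> nat \<Rightarrow> nat \<Rightarrow>
     (nat \<Rightarrow> 'a::metric_space measure) \<Rightarrow> (nat \<Rightarrow> 'a measure) \<Rightarrow>
     (nat \<Rightarrow> nat \<Rightarrow> real) \<Rightarrow> ennreal" where
  "discrete_cost \<phi> J0 J1 m0 m1 w =
     (\<Sum>j0\<in>{1..J0}. \<Sum>j1\<in>{1..J1}. ennreal (w j0 j1) * extend_top \<phi> (W_phi \<phi> (m0 j0) (m1 j1)))"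

definition W_dict ::
    "(real \<Rightarrow> real) \<Rightarrow> nat \<Rightarrow> nat \<Rightarrow> (nat \<Rightarrow> real) \<Rightarrow> (nat \<Rightarrow> real) \<Rightarrow>
     (nat \<Rightarrow> 'a::metric_space measure) \<Rightarrow> (nat \<Rightarrow> 'a measure) \<Rightarrow> ennreal" where
  "W_dict \<phi> J0 J1 l0 l1 m0 m1 =
     ext_inv \<phi> (INF w\<in>weight_couplings J0 J1 l0 l1. discrete_cost \<phi> J0 J1 m0 m1 w)"

end

theory Submission
  imports Defs
begin

text \<open>Both parts rest on one description of the admissible plans: the mixtures of couplings of atoms
  whose marginals are \<open>\<nu>0\<close> and \<open>\<nu>1\<close> are exactly the measures \<open>\<Sum> w j0 j1 * g j0 j1\<close> with \<open>w\<close> a coupling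
  of the weight vectors and \<open>g j0 j1\<close> a coupling of \<open>m0 j0\<close> and \<open>m1 j1\<close>
  (\<open>weighted_sum_in_mix_couplings\<close>, \<open>mix_couplings_decompose\<close>).  That every such sum is admissible is
  a computation of marginals.  Conversely, write an admissible plan as \<open>\<Sum> p k * q k\<close> with \<open>q k\<close> a
  coupling of atoms \<open>a k\<close>, \<open>b k\<close>.  The marginals \<open>\<Sum> p k * a k\<close> and \<open>\<Sum> l0 j * m0 j\<close> are equal, so by
  identifiability every atom has the same total weight in both.  Hence the mass \<open>p k\<close> can be shared
  among the indices \<open>j0\<close> with \<open>m0 j0 = a k\<close> and the indices \<open>j1\<close> with \<open>m1 j1 = b k\<close>, in proportion to
  the given weights; atoms that are repeated in the lists cause no harm.

  The cost of \<open>\<Sum> w j0 j1 * g j0 j1\<close> is \<open>\<Sum> w j0 j1 * cost (g j0 j1)\<close>, and \<open>\<phi> (W (m0 j0) (m1 j1))\<close> is the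
  least possible cost of \<open>g j0 j1\<close>.  So minimizing over \<open>g\<close> with \<open>w\<close> fixed gives the discrete cost of
  \<open>w\<close>, which proves the equality of the two infima.  A plan is minimal iff its \<open>w\<close> is minimal and
  \<open>g j0 j1\<close> is optimal wherever \<open>w j0 j1 > 0\<close>: since all the costs are finite
  (\<open>cost_finite\<close>), a single suboptimal \<open>g j0 j1\<close> of positive weight would make the sum larger.  Where
  \<open>w j0 j1 = 0\<close> the measure \<open>g j0 j1\<close> can be exchanged for an optimal one, and this is where the
  existence of optimal couplings is indispensable.

  Existence (\<open>exists_optimal_coupling\<close>) is shown for any lower semicontinuous cost, by the direct method.
  By Tychonoff's theorem a minimizing sequence, regarded as a sequence of set functions, has a cluster
  point.  Because the marginals are fixed and inner regular, a measurable rectangle is approximated from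
  inside by compact sets, with an error bound common to all couplings, and so is its complement.  The
  sets with this property form an algebra (\<open>approximable_algebra\<close>).  On it the finite intersection
  property makes the cluster point continuous at the empty set, and Caratheodory's theorem extends it
  to a measure.  A lower
  semicontinuous cost is a countable supremum of multiples of indicators of open rectangles, so its
  integral cannot jump up in the limit.\<close>

section \<open>Cluster points of sequences of measures\<close>

text \<open>The values of probability measures on all sets together form a point of the product space
  \<open>[0,1]\<close> to the power of all sets, which is compact.  A cluster point there is a limit along a filter finer
  than \<open>sequentially\<close>; with filters in place of subsequences the limit exists for all sets at the same
  time, countably many or not.\<close>

lemma cluster_set_function:
  fixes m :: "nat \<Rightarrow> 'a measure"
  assumes "\<And>n. prob_space (m n)"
  obtains G x where "G \<noteq> bot" "G \<le> sequentially"
    "\<And>E. ((\<lambda>n. measure (m n) E) \<longlongrightarrow> (x E :: real)) G"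
proof -
  define m' where "m' = (\<lambda>n E. measure (m n) E)"
  define U where "U = (PiE UNIV (\<lambda>_. {0..1}) :: ('a set \<Rightarrow> real) set)"
  have "compactin (product_topology (\<lambda>_. euclidean) UNIV) U"
    unfolding U_def by (simp add: compactin_PiE)
  then have "compact U"
    by (simp add: euclidean_product_topology)
  moreover have "\<forall>\<^sub>F y in filtermap m' sequentially. y \<in> U"
    using assms by (auto simp: eventually_filtermap U_def m'_def PiE_def intro!: always_eventually prob_space.prob_le_1)
  moreover have "filtermap m' sequentially \<noteq> bot"
    by (simp add: filtermap_bot_iff)
  ultimately obtain x where x: "inf (nhds x) (filtermap m' sequentially) \<noteq> bot"
    unfolding compact_filter by blast
  define G where "G = inf (filtercomap m' (nhds x)) sequentially"
  have "G \<noteq> bot"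
  proof
    assume "G = bot"
    then have "eventually (\<lambda>_. False) G" by simp
    then obtain P Q where P: "eventually P (filtercomap m' (nhds x))" and
      Q: "eventually Q sequentially" and PQ: "\<And>n. P n \<Longrightarrow> Q n \<Longrightarrow> False"
      unfolding G_def eventually_inf by blast
    from P obtain S where S: "eventually S (nhds x)" and SP: "\<And>n. S (m' n) \<Longrightarrow> P n"
      unfolding eventually_filtercomap by blast
    have "eventually (\<lambda>y. \<exists>n. Q n \<and> y = m' n) (filtermap m' sequentially)"
      unfolding eventually_filtermap using Q by eventually_elim blast
    then have "eventually (\<lambda>_. False) (inf (nhds x) (filtermap m' sequentially))"
      unfolding eventually_inf using S SP PQ by blast
    then show False using x by (simp add: trivial_limit_def)
  qed
  moreover have "G \<le> sequentially" by (simp add: G_def)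
  moreover have "((\<lambda>n. measure (m n) E) \<longlongrightarrow> x E) G" for E
  proof -
    have "(m' \<longlongrightarrow> x) G"
      unfolding G_def by (rule filterlim_mono[OF filterlim_filtercomap]) auto
    moreover have "continuous_on UNIV (\<lambda>y::'a set \<Rightarrow> real. y E)"
      using continuous_on_product_then_coordinatewise[OF continuous_on_id] by simp
    ultimately have "((\<lambda>n. m' n E) \<longlongrightarrow> x E) G"
      using continuous_on_tendsto_compose[of UNIV "\<lambda>y::'a set \<Rightarrow> real. y E" m' x G] by simp
    then show ?thesis by (simp add: m'_def)
  qed
  ultimately show thesis by (rule that)
qed

text \<open>The approximating compact set may depend on the error but not on the measure: this is
  tightness of the family \<open>P\<close>, relative to the set \<open>E\<close>.\<close>

definition compactly_approximable ::
  "'a::t2_space measure \<Rightarrow> 'a measure set \<Rightarrow> 'a set \<Rightarrow> bool" where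
  "compactly_approximable N P E \<longleftrightarrow> E \<in> sets N \<and>
     (\<forall>e>0. \<exists>C\<in>sets N. compact C \<and> C \<subseteq> E \<and> (\<forall>\<mu>\<in>P. measure \<mu> (E - C) < e))"

text \<open>Complements are built into the definition so that closure under complements is immediate; that
  compact sets are stable under both union and intersection does the rest.\<close>

definition approximable_algebra ::
  "'a::t2_space measure \<Rightarrow> 'a measure set \<Rightarrow> 'a set set" where
  "approximable_algebra N P =
     {E. compactly_approximable N P E \<and> compactly_approximable N P (space N - E)}"

lemma measure_diff_union_le:
  assumes "prob_space \<mu>" "sets \<mu> = sets N" "E \<in> sets N" "F \<in> sets N" "C \<in> sets N" "D \<in> sets N"
    "S \<in> sets N" "S \<subseteq> (E - C) \<union> (F - D)"
  shows "measure \<mu> S \<le> measure \<mu> (E - C) + measure \<mu> (F - D)"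
proof -
  interpret prob_space \<mu> by fact
  have "measure \<mu> S \<le> measure \<mu> ((E - C) \<union> (F - D))"
    using assms by (intro finite_measure_mono) auto
  also have "\<dots> \<le> measure \<mu> (E - C) + measure \<mu> (F - D)"
    using assms by (intro measure_Un_le) auto
  finally show ?thesis .
qed

lemma compactly_approximable_Un_Int:
  assumes P: "P \<subseteq> prob_measures N"
    and E: "compactly_approximable N P E" and F: "compactly_approximable N P F"
  shows "compactly_approximable N P (E \<union> F)" "compactly_approximable N P (E \<inter> F)"
proof -
  have EF: "E \<in> sets N" "F \<in> sets N" using E F by (auto simp: compactly_approximable_def)
  have ex: "(\<exists>C\<in>sets N. compact C \<and> C \<subseteq> E \<union> F \<and> (\<forall>\<mu>\<in>P. measure \<mu> (E \<union> F - C) < e)) \<and>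
        (\<exists>C\<in>sets N. compact C \<and> C \<subseteq> E \<inter> F \<and> (\<forall>\<mu>\<in>P. measure \<mu> (E \<inter> F - C) < e))"
    if "e > 0" for e :: real
  proof -
    from that have "e / 2 > 0" by simp
    with E F obtain C D where CD: "C \<in> sets N" "compact C" "C \<subseteq> E" "\<forall>\<mu>\<in>P. measure \<mu> (E - C) < e/2"
      "D \<in> sets N" "compact D" "D \<subseteq> F" "\<forall>\<mu>\<in>P. measure \<mu> (F - D) < e/2"
      unfolding compactly_approximable_def by metis
    have le: "measure \<mu> S < e" if "\<mu> \<in> P" "S \<in> sets N" "S \<subseteq> (E - C) \<union> (F - D)" for \<mu> S
    proof -
      have "measure \<mu> S \<le> measure \<mu> (E - C) + measure \<mu> (F - D)"
        using that P EF CD by (intro measure_diff_union_le[of \<mu> N]) (auto simp: prob_measures_def)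
      also have "\<dots> < e" using CD(4,8) that(1) by fastforce
      finally show ?thesis .
    qed
    have "\<forall>\<mu>\<in>P. measure \<mu> (E \<union> F - (C \<union> D)) < e"
      using EF CD by (intro ballI le) auto
    moreover have "\<forall>\<mu>\<in>P. measure \<mu> (E \<inter> F - (C \<inter> D)) < e"
      using EF CD by (intro ballI le) auto
    moreover have "compact (C \<union> D)" "compact (C \<inter> D)"
      using CD by (auto intro: compact_Un compact_Int)
    ultimately show ?thesis using CD(1,3,5,7) by (intro conjI bexI[of _ "C \<union> D"] bexI[of _ "C \<inter> D"]) auto
  qed
  show "compactly_approximable N P (E \<union> F)"
    using EF ex unfolding compactly_approximable_def by (meson sets.Un)
  show "compactly_approximable N P (E \<inter> F)"
    using EF ex unfolding compactly_approximable_def by (meson sets.Int)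
qed

lemma algebra_approximable_algebra:
  assumes P: "P \<subseteq> prob_measures N" and top: "compactly_approximable N P (space N)"
  shows "algebra (space N) (approximable_algebra N P)"
proof -
  have empty: "compactly_approximable N P {}"
    by (auto simp: compactly_approximable_def intro!: bexI[of _ "{}"])
  have sub: "E \<subseteq> space N" if "compactly_approximable N P E" for E
    using that by (auto simp: compactly_approximable_def dest: sets.sets_into_space)
  show ?thesis
    unfolding algebra_iff_Un
  proof (intro conjI ballI)
    show "approximable_algebra N P \<subseteq> Pow (space N)"
      using sub by (auto simp: approximable_algebra_def)
    show "{} \<in> approximable_algebra N P" using empty top by (simp add: approximable_algebra_def)
    fix E assume E: "E \<in> approximable_algebra N P"
    then have "E \<subseteq> space N" using sub by (auto simp: approximable_algebra_def)
    then have "space N - (space N - E) = E" by auto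
    then show "space N - E \<in> approximable_algebra N P"
      using E by (simp add: approximable_algebra_def)
    fix F assume F: "F \<in> approximable_algebra N P"
    have "space N - (E \<union> F) = (space N - E) \<inter> (space N - F)" by auto
    then show "E \<union> F \<in> approximable_algebra N P"
      using E F compactly_approximable_Un_Int[OF P] by (simp add: approximable_algebra_def)
  qed
qed

text \<open>A Dini argument: compact sets \<open>C k\<close> inside \<open>E k\<close> have empty intersection, so finitely many of them
  already do, and then a late \<open>E j\<close> is covered by the small differences \<open>E i - C i\<close>.\<close>

lemma approximable_decseq_uniform:
  fixes N :: "'a::t2_space measure"
  assumes P: "P \<subseteq> prob_measures N"
    and E: "\<And>k. compactly_approximable N P (E k)" and dec: "decseq E" and empty: "(\<Inter>k. E k) = {}"
    and e: "e > 0"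
  obtains k where "\<And>\<mu> j. \<mu> \<in> P \<Longrightarrow> j \<ge> k \<Longrightarrow> measure \<mu> (E j) < e"
proof -
  \<comment> \<open>The errors add up to at most \<open>e / 2\<close>, which leaves room for a strict inequality.\<close>
  have "\<exists>C\<in>sets N. compact C \<and> C \<subseteq> E k \<and> (\<forall>\<mu>\<in>P. measure \<mu> (E k - C) < e * (1/2)^Suc k / 2)" for k
  proof -
    have "e * (1/2)^Suc k / 2 > 0" using e by simp
    then show ?thesis using E[of k] unfolding compactly_approximable_def by blast
  qed
  then obtain C where C: "\<And>k. C k \<in> sets N" "\<And>k. compact (C k)" "\<And>k. C k \<subseteq> E k"
    "\<And>k \<mu>. \<mu> \<in> P \<Longrightarrow> measure \<mu> (E k - C k) < e * (1/2)^Suc k / 2"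
    by metis
  have Es: "E k \<in> sets N" for k using E[of k] by (simp add: compactly_approximable_def)
  have "(\<Inter>k. C k) \<subseteq> (\<Inter>k. E k)" by (rule INF_mono') (rule C(3))
  then have "C 0 \<inter> (\<Inter>k\<in>UNIV. C k) = {}" using empty by simp
  moreover have "closed (C k)" for k using C(2) by (rule compact_imp_closed)
  ultimately have "\<exists>I. finite I \<and> C 0 \<inter> (\<Inter>k\<in>I. C k) = {}"
    using compact_imp_fip_image[OF C(2), of UNIV C 0] by blast
  then obtain I where I: "finite I" "C 0 \<inter> (\<Inter>k\<in>I. C k) = {}" by blast
  define k where "k = Max (insert 0 I)"
  have k: "i \<le> k" if "i \<in> insert 0 I" for i using that I(1) by (simp add: k_def)
  have "measure \<mu> (E j) < e" if \<mu>: "\<mu> \<in> P" and j: "j \<ge> k" for \<mu> j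
  proof -
    have s: "sets \<mu> = sets N" using P \<mu> by (auto simp: prob_measures_def)
    interpret prob_space \<mu> using P \<mu> by (auto simp: prob_measures_def)
    have "E j \<subseteq> (\<Union>i\<in>{..k}. E i - C i)"
    proof
      fix x assume x: "x \<in> E j"
      have "x \<in> E i" if "i \<le> k" for i using x decseqD[OF dec, of i j] that j by auto
      moreover have "\<exists>i\<le>k. x \<notin> C i" using I(2) k by fastforce
      ultimately show "x \<in> (\<Union>i\<in>{..k}. E i - C i)" by auto
    qed
    then have "measure \<mu> (E j) \<le> measure \<mu> (\<Union>i\<in>{..k}. E i - C i)"
      using Es C(1) s by (intro finite_measure_mono) auto
    also have "\<dots> \<le> (\<Sum>i\<in>{..k}. measure \<mu> (E i - C i))"
      using Es C(1) s by (intro finite_measure_subadditive_finite) auto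
    also have "\<dots> \<le> (\<Sum>i\<in>{..k}. e * (1/2)^Suc i / 2)"
      using C(4)[OF \<mu>] by (intro sum_mono less_imp_le)
    also have "\<dots> = e / 2 * (\<Sum>i\<in>{..k}. (1/2)^Suc i)"
      by (simp add: sum_distrib_left algebra_simps)
    also have "(\<Sum>i\<in>{..k}. (1/2::real)^Suc i) = 1 - (1/2)^Suc k"
      by (induction k) (auto simp: field_simps)
    also have "e / 2 * (1 - (1/2)^Suc k) < e"
      using e by (simp add: field_simps add_pos_pos)
    finally show ?thesis .
  qed
  then show thesis by (rule that)
qed

text \<open>The cluster set function is finitely additive everywhere but need not be countably additive.
  On the approximable algebra it is, by \<open>approximable_decseq_uniform\<close>; its Caratheodory extension may
  differ from it outside of the algebra, which is why convergence is claimed only there.\<close>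

lemma cluster_measure:
  fixes N :: "'a::t2_space measure"
  assumes P: "P \<subseteq> prob_measures N" and top: "compactly_approximable N P (space N)"
    and gen: "sets N \<subseteq> sigma_sets (space N) (approximable_algebra N P)"
    and m: "\<And>n. m n \<in> P"
  obtains G \<mu> where "G \<noteq> bot" "G \<le> sequentially" "\<mu> \<in> prob_measures N"
    "\<And>E. E \<in> approximable_algebra N P \<Longrightarrow> ((\<lambda>n. measure (m n) E) \<longlongrightarrow> measure \<mu> E) G"
proof -
  let ?R = "approximable_algebra N P"
  have pm: "prob_space (m n)" and sm: "sets (m n) = sets N" for n
    using m P by (auto simp: prob_measures_def)
  have spm: "space (m n) = space N" for n using sm sets_eq_imp_space_eq by blast
  interpret R: algebra "space N" ?R
    by (rule algebra_approximable_algebra[OF P top])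
  have RN: "?R \<subseteq> sets N" by (auto simp: approximable_algebra_def compactly_approximable_def)
  obtain G x where G: "G \<noteq> bot" "G \<le> sequentially"
    and lim: "\<And>E. ((\<lambda>n. measure (m n) E) \<longlongrightarrow> (x E :: real)) G"
    by (rule cluster_set_function[of m]) (rule pm, blast)
  have xpos: "x E \<ge> 0" for E
    using lim by (rule tendsto_lowerbound) (auto simp: G)
  define f where "f E = ennreal (x E)" for E
  have "x {} = 0" using tendsto_unique[OF G(1) lim[of "{}"]] by simp
  then have "positive ?R f" by (simp add: positive_def f_def)
  moreover have "additive ?R f"
  proof (unfold additive_def, intro ballI impI)
    fix E F assume EF: "E \<in> ?R" "F \<in> ?R" "E \<inter> F = {}"
    have "measure (m n) (E \<union> F) = measure (m n) E + measure (m n) F" for n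
      using EF RN sm[of n]
      by (intro finite_measure.finite_measure_Union prob_space.finite_measure pm) auto
    then have "((\<lambda>n. measure (m n) (E \<union> F)) \<longlongrightarrow> x E + x F) G"
      using tendsto_add[OF lim[of E] lim[of F]] by simp
    then have "x (E \<union> F) = x E + x F" using tendsto_unique[OF G(1) lim[of "E \<union> F"]] by blast
    then show "f (E \<union> F) = f E + f F" by (simp add: f_def xpos)
  qed
  moreover have "(\<lambda>i. f (A i)) \<longlonglongrightarrow> 0"
    if A: "range A \<subseteq> ?R" "decseq A" "(\<Inter>i. A i) = {}" for A
  proof -
    have "(\<lambda>i. x (A i)) \<longlonglongrightarrow> 0"
    proof (rule LIMSEQ_I)
      fix e :: real assume "e > 0"
      then have "e / 2 > 0" by simp
      moreover have "compactly_approximable N P (A k)" for k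
        using A(1) by (auto simp: approximable_algebra_def)
      ultimately obtain k where k: "\<And>\<mu> j. \<mu> \<in> P \<Longrightarrow> j \<ge> k \<Longrightarrow> measure \<mu> (A j) < e / 2"
        using approximable_decseq_uniform[OF P _ A(2,3)] by blast
      have "norm (x (A j) - 0) < e" if "j \<ge> k" for j
      proof -
        have "x (A j) \<le> e / 2"
          using lim[of "A j"] by (rule tendsto_upperbound) (use k m that G in \<open>auto intro!: always_eventually less_imp_le\<close>)
        then show ?thesis using xpos[of "A j"] \<open>e > 0\<close> by simp
      qed
      then show "\<exists>k. \<forall>j\<ge>k. norm (x (A j) - 0) < e" by blast
    qed
    then show ?thesis unfolding f_def using tendsto_ennrealI by fastforce
  qed
  ultimately have "\<exists>\<mu>. (\<forall>s\<in>?R. \<mu> s = f s) \<and>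
      measure_space (space N) (sigma_sets (space N) ?R) \<mu>"
    by (intro R.caratheodory_empty_continuous) (simp_all add: f_def[abs_def])
  then obtain \<mu>0 where \<mu>0: "\<And>s. s \<in> ?R \<Longrightarrow> \<mu>0 s = f s"
    "measure_space (space N) (sigma_sets (space N) ?R) \<mu>0" by blast
  define \<mu> where "\<mu> = measure_of (space N) ?R \<mu>0"
  have RPow: "?R \<subseteq> Pow (space N)" using R.space_closed .
  have "sigma_sets (space N) ?R \<subseteq> sets N"
    using RN sets.sigma_sets_subset by blast
  then have s\<mu>: "sets \<mu> = sets N"
    using gen RPow by (simp add: \<mu>_def)
  have em: "emeasure \<mu> E = f E" if "E \<in> ?R" for E
  proof -
    have "emeasure \<mu> E = \<mu>0 E"
      using \<mu>0(2) that RPow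
      by (intro emeasure_measure_of[OF \<mu>_def]) (auto simp: measure_space_def \<mu>_def)
    then show ?thesis using \<mu>0(1) that by simp
  qed
  have "space N \<in> ?R" by (rule R.top)
  have "x (space N) = 1"
    using tendsto_unique[OF G(1) lim[of "space N"]] prob_space.prob_space[OF pm] spm by simp
  then have "emeasure \<mu> (space N) = 1"
    using em[OF \<open>space N \<in> ?R\<close>] by (simp add: f_def)
  then have "\<mu> \<in> prob_measures N"
    using s\<mu> sets_eq_imp_space_eq[OF s\<mu>] by (auto simp: prob_measures_def intro: prob_spaceI)
  moreover have "((\<lambda>n. measure (m n) E) \<longlongrightarrow> measure \<mu> E) G" if "E \<in> ?R" for E
    using lim[of E] em[OF that] xpos[of E] by (simp add: measure_def f_def)
  ultimately show thesis by (rule that[OF G])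
qed

section \<open>Lower semicontinuity of the integral\<close>

lemma nn_integral_simple_tendsto:
  fixes h :: "'a \<Rightarrow> ennreal"
  assumes R: "algebra (space N) R" and RN: "R \<subseteq> sets N"
    and m: "\<And>n. m n \<in> prob_measures N" and \<mu>: "\<mu> \<in> prob_measures N"
    and lim: "\<And>E. E \<in> R \<Longrightarrow> ((\<lambda>n. measure (m n) E) \<longlongrightarrow> measure \<mu> E) G"
    and fin: "finite (h ` space N)" and top: "\<And>p. h p \<noteq> \<top>"
    and level: "\<And>v. {p\<in>space N. v \<le> h p} \<in> R" "\<And>v. {p\<in>space N. v < h p} \<in> R"
  shows "((\<lambda>n. \<integral>\<^sup>+p. h p \<partial>m n) \<longlongrightarrow> (\<integral>\<^sup>+p. h p \<partial>\<mu>)) G"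
proof -
  interpret R: algebra "space N" R by fact
  have lev: "h -` {v} \<inter> space N \<in> R" for v
  proof -
    have "h -` {v} \<inter> space N = {p\<in>space N. v \<le> h p} - {p\<in>space N. v < h p}" by auto
    then show ?thesis using level by (metis R.Diff)
  qed
  have int: "(\<integral>\<^sup>+p. h p \<partial>M) = (\<Sum>v\<in>h ` space N. v * ennreal (measure M (h -` {v} \<inter> space N)))"
    if "M \<in> prob_measures N" for M
  proof -
    have M: "prob_space M" "sets M = sets N" "space M = space N"
      using that by (auto simp: prob_measures_def dest: sets_eq_imp_space_eq)
    have "simple_function M h"
      unfolding simple_function_def using fin lev RN M by auto
    then show ?thesis
      using M(3) finite_measure.emeasure_eq_measure[OF prob_space.finite_measure[OF M(1)]]
      by (simp add: nn_integral_eq_simple_integral simple_integral_def)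
  qed
  have "((\<lambda>n. \<Sum>v\<in>h ` space N. v * ennreal (measure (m n) (h -` {v} \<inter> space N)))
      \<longlongrightarrow> (\<Sum>v\<in>h ` space N. v * ennreal (measure \<mu> (h -` {v} \<inter> space N)))) G"
    using top by (intro tendsto_sum ennreal_tendsto_cmult tendsto_ennrealI lim lev)
      (auto simp: less_top)
  then show ?thesis using int m \<mu> by simp
qed

text \<open>Fatou's lemma fails along a general filter.  The integrand is therefore exhausted by finite
  maxima \<open>h k\<close>, whose level sets belong to the algebra on which the measures converge; each of the
  integrals of \<open>h k\<close> passes to the limit, and monotone convergence is applied to the limit measure alone.\<close>

lemma nn_integral_SUP_indicator_le_lim:
  fixes S :: "nat \<Rightarrow> 'a set" and r :: "nat \<Rightarrow> ennreal"
  assumes R: "algebra (space N) R" and RN: "R \<subseteq> sets N"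
    and m: "\<And>n. m n \<in> prob_measures N" and \<mu>: "\<mu> \<in> prob_measures N"
    and lim: "\<And>E. E \<in> R \<Longrightarrow> ((\<lambda>n. measure (m n) E) \<longlongrightarrow> measure \<mu> E) G"
    and G: "G \<noteq> bot"
    and S: "\<And>i. S i \<in> R" and r: "\<And>i. r i \<noteq> \<top>"
    and c: "\<And>p. p \<in> space N \<Longrightarrow> c p = (SUP i. r i * indicator (S i) p)"
    and v: "((\<lambda>n. \<integral>\<^sup>+p. c p \<partial>m n) \<longlongrightarrow> v) G"
  shows "(\<integral>\<^sup>+p. c p \<partial>\<mu>) \<le> v"
proof -
  interpret R: algebra "space N" R by fact
  define h where "h k p = (SUP i\<in>{..k}. r i * indicator (S i) p)" for k :: nat and p
  have h0: "h 0 p = r 0 * indicator (S 0) p" for p by (simp add: h_def)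
  have hS: "h (Suc k) p = max (r (Suc k) * indicator (S (Suc k)) p) (h k p)" for k p
    by (simp add: h_def atMost_Suc sup_max)
  have ri: "(\<lambda>p. r i * indicator (S i) p) ` space N \<subseteq> {0, r i}" for i
    by (auto simp: indicator_def)
  have hfin: "finite (h k ` space N)" for k
  proof (induction k)
    case 0
    then show ?case using ri[of 0] by (simp add: h0 finite_subset)
  next
    case (Suc k)
    have "h (Suc k) ` space N \<subseteq> {0, r (Suc k)} \<union> h k ` space N"
      by (auto simp: hS max_def indicator_def)
    then show ?case using Suc by (meson finite.simps finite_Un finite_subset)
  qed
  have htop: "h k p \<noteq> \<top>" for k p
    by (induction k) (auto simp: h0 hS max_def indicator_def r)
  have ind: "{p\<in>space N. a \<le> r i * indicator (S i) p} \<in> R \<and> {p\<in>space N. a < r i * indicator (S i) p} \<in> R" for a i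
  proof -
    have "S i \<subseteq> space N" using S R.sets_into_space by auto
    then have "{p\<in>space N. a \<le> r i * indicator (S i) p} \<in> {{}, S i, space N}"
      "{p\<in>space N. a < r i * indicator (S i) p} \<in> {{}, S i, space N}"
      by (auto simp: indicator_def)
    moreover have "{{}, S i, space N} \<subseteq> R" using S by auto
    ultimately show ?thesis by blast
  qed
  have hlev: "{p\<in>space N. a \<le> h k p} \<in> R \<and> {p\<in>space N. a < h k p} \<in> R" for a k
  proof (induction k)
    case 0
    then show ?case using ind by (simp add: h0)
  next
    case (Suc k)
    have eq: "{p\<in>space N. a \<le> h (Suc k) p} =
        {p\<in>space N. a \<le> r (Suc k) * indicator (S (Suc k)) p} \<union> {p\<in>space N. a \<le> h k p}"
      "{p\<in>space N. a < h (Suc k) p} =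
        {p\<in>space N. a < r (Suc k) * indicator (S (Suc k)) p} \<union> {p\<in>space N. a < h k p}"
      by (auto simp: hS less_max_iff_disj le_max_iff_disj)
    show ?case unfolding eq using ind[of a "Suc k"] Suc by (intro conjI R.Un) auto
  qed
  have s\<mu>: "sets \<mu> = sets N" "space \<mu> = space N"
    using \<mu> by (auto simp: prob_measures_def dest: sets_eq_imp_space_eq)
  have hc: "h k p \<le> c p" if "p \<in> space N" for k p
    unfolding c[OF that] h_def by (rule SUP_subset_mono) auto
  have hle: "(\<integral>\<^sup>+p. h k p \<partial>\<mu>) \<le> v" for k
  proof (rule tendsto_le[OF G v])
    show "((\<lambda>n. \<integral>\<^sup>+p. h k p \<partial>m n) \<longlongrightarrow> (\<integral>\<^sup>+p. h k p \<partial>\<mu>)) G"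
      using hfin htop hlev by (intro nn_integral_simple_tendsto[OF R RN m \<mu> lim]) auto
    have "space (m n) = space N" for n
      using m[of n] by (auto simp: prob_measures_def dest: sets_eq_imp_space_eq)
    then show "\<forall>\<^sub>F n in G. (\<integral>\<^sup>+p. h k p \<partial>m n) \<le> (\<integral>\<^sup>+p. c p \<partial>m n)"
      using hc by (intro always_eventually allI nn_integral_mono) auto
  qed
  have "c p = (SUP k. h k p)" if "p \<in> space N" for p
  proof (rule antisym)
    show "(SUP k. h k p) \<le> c p" using hc[OF that] by (rule SUP_least)
    show "c p \<le> (SUP k. h k p)"
      unfolding c[OF that]
    proof (rule SUP_least)
      fix i
      have "r i * indicator (S i) p \<le> h i p" unfolding h_def by (rule SUP_upper) simp
      also have "\<dots> \<le> (SUP k. h k p)" by (rule SUP_upper) simp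
      finally show "r i * indicator (S i) p \<le> (SUP k. h k p)" .
    qed
  qed
  then have "(\<integral>\<^sup>+p. c p \<partial>\<mu>) = (\<integral>\<^sup>+p. (SUP k. h k p) \<partial>\<mu>)"
    using s\<mu> by (intro nn_integral_cong) auto
  also have "\<dots> = (SUP k. \<integral>\<^sup>+p. h k p \<partial>\<mu>)"
  proof (rule nn_integral_monotone_convergence_SUP)
    show "incseq h" by (auto simp: incseq_Suc_iff le_fun_def hS)
    show "h k \<in> borel_measurable \<mu>" for k
      using hlev RN s\<mu> by (intro borel_measurableI_greater) auto
  qed
  also have "\<dots> \<le> v" using hle by (rule SUP_least)
  finally show ?thesis .
qed

section \<open>Optimal couplings exist\<close>

text \<open>Inner regularity of finite Borel measures on a Polish space, applied to the image of \<open>M\<close> under the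
  inclusion of \<open>\<Omega>\<close>.  As \<open>\<Omega>\<close> is Borel, the subsets of \<open>\<Omega>\<close> measurable for \<open>M\<close> are Borel sets of the
  whole space, and the compact sets found there lie in \<open>\<Omega>\<close>.\<close>

lemma compactly_approximable_borel:
  fixes \<Omega> :: "'a::polish_space set"
  assumes \<Omega>: "\<Omega> \<in> sets borel" and M: "M \<in> prob_measures (borel_on \<Omega>)" and A: "A \<in> sets M"
  shows "compactly_approximable M {M} A"
  unfolding compactly_approximable_def
proof (intro conjI allI impI A)
  fix e :: real assume e: "e > 0"
  have sM: "sets M = sets (borel_on \<Omega>)" and "prob_space M"
    using M by (auto simp: prob_measures_def)
  interpret prob_space M by fact
  have spM: "space M = \<Omega>" using sets_eq_imp_space_eq[OF sM] by (simp add: space_restrict_space)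
  have mem: "B \<in> sets M \<longleftrightarrow> B \<in> sets borel \<and> B \<subseteq> \<Omega>" for B
    using \<Omega> by (auto simp: sM sets_restrict_space_iff)
  have meas: "(\<lambda>x. x) \<in> measurable M borel"
    using measurable_restrict_space1[OF measurable_ident_sets[OF refl], of borel \<Omega>]
    by (simp add: measurable_cong_sets[OF sM refl] id_def)
  define M' where "M' = distr M borel (\<lambda>x. x)"
  interpret M': prob_space M' unfolding M'_def by (rule prob_space_distr[OF meas])
  have M': "measure M' B = measure M B" if "B \<in> sets M" for B
    using that meas mem[of B] spM by (auto simp: M'_def measure_distr intro!: arg_cong[of _ _ "measure M"])
  have sM': "sets M' = sets borel" by (simp add: M'_def)
  have "emeasure M' A = (SUP K\<in>{K. K \<subseteq> A \<and> compact K}. emeasure M' K)"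
    using A mem sM' M'.emeasure_finite by (intro inner_regular) auto
  then have "\<exists>K\<in>{K. K \<subseteq> A \<and> compact K}. emeasure M' A < emeasure M' K + ennreal e"
  proof (rule SUP_approx_ennreal[OF e, rotated])
    show "{K. K \<subseteq> A \<and> compact K} \<noteq> {}" using compact_empty by blast
  qed (simp add: M'.emeasure_finite)
  then obtain K where K: "K \<subseteq> A" "compact K" "emeasure M' A < emeasure M' K + ennreal e"
    by blast
  have Kb: "K \<in> sets M" using K(1,2) A mem by (auto intro: borel_compact)
  have "measure M' A < measure M' K + e"
    using K(3) e by (simp add: M'.emeasure_eq_measure ennreal_plus[symmetric] ennreal_less_iff del: ennreal_plus)
  then have "measure M (A - K) < e"
    using M'[OF A] M'[OF Kb] finite_measure_Diff[OF A Kb K(1)] by simp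
  then show "\<exists>C\<in>sets M. compact C \<and> C \<subseteq> A \<and> (\<forall>\<mu>\<in>{M}. measure \<mu> (A - C) < e)"
    using K Kb by auto
qed

lemma couplingsD:
  assumes "\<gamma> \<in> couplings M0 M1"
  shows "prob_space \<gamma>" "sets \<gamma> = sets (M0 \<Otimes>\<^sub>M M1)" "space \<gamma> = space M0 \<times> space M1"
    "A \<in> sets M0 \<Longrightarrow> emeasure \<gamma> (A \<times> space M1) = emeasure M0 A"
    "B \<in> sets M1 \<Longrightarrow> emeasure \<gamma> (space M0 \<times> B) = emeasure M1 B"
proof -
  show *: "prob_space \<gamma>" "sets \<gamma> = sets (M0 \<Otimes>\<^sub>M M1)"
    using assms by (auto simp: couplings_def prob_measures_def)
  show sp: "space \<gamma> = space M0 \<times> space M1"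
    using sets_eq_imp_space_eq[OF *(2)] by (simp add: space_pair_measure)
  have m: "fst \<in> measurable \<gamma> M0" "snd \<in> measurable \<gamma> M1"
    by (simp_all add: measurable_cong_sets[OF *(2) refl])
  have d: "distr \<gamma> M0 fst = M0" "distr \<gamma> M1 snd = M1" using assms by (auto simp: couplings_def)
  show "emeasure \<gamma> (A \<times> space M1) = emeasure M0 A" if A: "A \<in> sets M0"
  proof -
    have "fst -` A \<inter> space \<gamma> = A \<times> space M1" using sets.sets_into_space[OF A] sp by auto
    then show ?thesis using emeasure_distr[OF m(1) A] d by simp
  qed
  show "emeasure \<gamma> (space M0 \<times> B) = emeasure M1 B" if B: "B \<in> sets M1"
  proof -
    have "snd -` B \<inter> space \<gamma> = space M0 \<times> B" using sets.sets_into_space[OF B] sp by auto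
    then show ?thesis using emeasure_distr[OF m(2) B] d by simp
  qed
qed

lemma couplingsI:
  assumes "prob_space \<gamma>" "sets \<gamma> = sets (M0 \<Otimes>\<^sub>M M1)"
    and A: "\<And>A. A \<in> sets M0 \<Longrightarrow> emeasure \<gamma> (A \<times> space M1) = emeasure M0 A"
    and B: "\<And>B. B \<in> sets M1 \<Longrightarrow> emeasure \<gamma> (space M0 \<times> B) = emeasure M1 B"
  shows "\<gamma> \<in> couplings M0 M1"
proof -
  have sp: "space \<gamma> = space M0 \<times> space M1"
    using sets_eq_imp_space_eq[OF assms(2)] by (simp add: space_pair_measure)
  have m: "fst \<in> measurable \<gamma> M0" "snd \<in> measurable \<gamma> M1"
    by (simp_all add: measurable_cong_sets[OF assms(2) refl])
  have "distr \<gamma> M0 fst = M0"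
  proof (rule measure_eqI)
    fix E assume "E \<in> sets (distr \<gamma> M0 fst)"
    then have E: "E \<in> sets M0" by simp
    have "fst -` E \<inter> space \<gamma> = E \<times> space M1" using sets.sets_into_space[OF E] sp by auto
    then show "emeasure (distr \<gamma> M0 fst) E = emeasure M0 E"
      using emeasure_distr[OF m(1) E] A[OF E] by simp
  qed simp
  moreover have "distr \<gamma> M1 snd = M1"
  proof (rule measure_eqI)
    fix E assume "E \<in> sets (distr \<gamma> M1 snd)"
    then have E: "E \<in> sets M1" by simp
    have "snd -` E \<inter> space \<gamma> = space M0 \<times> E" using sets.sets_into_space[OF E] sp by auto
    then show "emeasure (distr \<gamma> M1 snd) E = emeasure M1 E"
      using emeasure_distr[OF m(2) E] B[OF E] by simp
  qed simp
  ultimately show ?thesis using assms(1,2) by (simp add: couplings_def prob_measures_def)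
qed

lemma pair_measure_in_couplings:
  assumes "prob_space M0" "prob_space M1"
  shows "M0 \<Otimes>\<^sub>M M1 \<in> couplings M0 M1"
proof -
  interpret M0: prob_space M0 by fact
  interpret M1: prob_space M1 by fact
  interpret pair_prob_space M0 M1 ..
  show ?thesis
    by (rule couplingsI)
      (auto simp: M1.emeasure_pair_measure_Times M0.emeasure_space_1 M1.emeasure_space_1 prob_space_axioms)
qed

text \<open>The mass of \<open>A \<times> B - K \<times> L\<close> is bounded by the marginal masses of \<open>A - K\<close> and \<open>B - L\<close>, which do not
  depend on the coupling.\<close>

lemma compactly_approximable_Times:
  fixes M0 :: "'a::t2_space measure" and M1 :: "'b::t2_space measure"
  assumes A: "compactly_approximable M0 {M0} A" and B: "compactly_approximable M1 {M1} B"
  shows "compactly_approximable (M0 \<Otimes>\<^sub>M M1) (couplings M0 M1) (A \<times> B)"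
  unfolding compactly_approximable_def
proof (intro conjI allI impI)
  have AB: "A \<in> sets M0" "B \<in> sets M1" using A B by (auto simp: compactly_approximable_def)
  then show "A \<times> B \<in> sets (M0 \<Otimes>\<^sub>M M1)" by simp
  fix e :: real assume "e > 0"
  then have "e / 2 > 0" by simp
  obtain K where K: "K \<in> sets M0" "compact K" "K \<subseteq> A" "measure M0 (A - K) < e / 2"
    using A \<open>e / 2 > 0\<close> unfolding compactly_approximable_def by blast
  obtain L where L: "L \<in> sets M1" "compact L" "L \<subseteq> B" "measure M1 (B - L) < e / 2"
    using B \<open>e / 2 > 0\<close> unfolding compactly_approximable_def by blast
  have "measure \<gamma> (A \<times> B - K \<times> L) < e" if \<gamma>: "\<gamma> \<in> couplings M0 M1" for \<gamma>
  proof -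
    interpret prob_space \<gamma> by (rule couplingsD(1)[OF \<gamma>])
    have "measure \<gamma> (A \<times> B - K \<times> L) \<le> measure \<gamma> ((A - K) \<times> space M1 \<union> space M0 \<times> (B - L))"
      using AB K(1) L(1) by (intro finite_measure_mono)
        (auto simp: couplingsD(2)[OF \<gamma>] dest: sets.sets_into_space)
    also have "\<dots> \<le> measure \<gamma> ((A - K) \<times> space M1) + measure \<gamma> (space M0 \<times> (B - L))"
      using AB K(1) L(1) by (intro measure_Un_le) (auto simp: couplingsD(2)[OF \<gamma>])
    also have "\<dots> = measure M0 (A - K) + measure M1 (B - L)"
      using AB K(1) L(1) by (simp add: measure_def couplingsD(4,5)[OF \<gamma>])
    finally show ?thesis using K(4) L(4) by simp
  qed
  then show "\<exists>C\<in>sets (M0 \<Otimes>\<^sub>M M1). compact C \<and> C \<subseteq> A \<times> B \<and>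
      (\<forall>\<gamma>\<in>couplings M0 M1. measure \<gamma> (A \<times> B - C) < e)"
    using K L by (intro bexI[of _ "K \<times> L"]) (auto intro: compact_Times)
qed

lemma Times_in_approximable_algebra:
  fixes M0 :: "'a::t2_space measure" and M1 :: "'b::t2_space measure"
  assumes M0: "\<And>A. A \<in> sets M0 \<Longrightarrow> compactly_approximable M0 {M0} A"
    and M1: "\<And>B. B \<in> sets M1 \<Longrightarrow> compactly_approximable M1 {M1} B"
    and AB: "A \<in> sets M0" "B \<in> sets M1"
  shows "A \<times> B \<in> approximable_algebra (M0 \<Otimes>\<^sub>M M1) (couplings M0 M1)"
proof -
  have sub: "A \<subseteq> space M0" "B \<subseteq> space M1" using AB sets.sets_into_space by auto
  have "couplings M0 M1 \<subseteq> prob_measures (M0 \<Otimes>\<^sub>M M1)" by (auto simp: couplings_def)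
  then have "compactly_approximable (M0 \<Otimes>\<^sub>M M1) (couplings M0 M1)
      ((space M0 - A) \<times> space M1 \<union> space M0 \<times> (space M1 - B))"
    using AB by (intro compactly_approximable_Un_Int(1) compactly_approximable_Times M0 M1) auto
  moreover have "space (M0 \<Otimes>\<^sub>M M1) - A \<times> B = (space M0 - A) \<times> space M1 \<union> space M0 \<times> (space M1 - B)"
    using sub by (auto simp: space_pair_measure)
  ultimately show ?thesis
    using AB by (simp add: approximable_algebra_def compactly_approximable_Times M0 M1)
qed

text \<open>Around each point \<open>p\<close> and below each rational value less than \<open>c p\<close> there is a rectangle from a
  countable basis on which \<open>c\<close> exceeds that value.\<close>

lemma lower_semicontinuous_SUP_rectangles:
  fixes c :: "'a::second_countable_topology \<times> 'b::second_countable_topology \<Rightarrow> ennreal"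
  assumes lsc: "\<And>t. open {p. t < c p}"
  obtains r :: "nat \<Rightarrow> ennreal" and U V where "\<And>i. r i \<noteq> \<top>" "\<And>i. open (U i)" "\<And>i. open (V i)"
    "\<And>p. c p = (SUP i. r i * indicator (U i \<times> V i) p)"
proof -
  obtain B0 :: "'a set set" where B0: "countable B0" "topological_basis B0"
    using ex_countable_basis by blast
  obtain B1 :: "'b set set" where B1: "countable B1" "topological_basis B1"
    using ex_countable_basis by blast
  \<comment> \<open>The degenerate triple keeps \<open>I\<close> nonempty, so that it can be enumerated.\<close>
  define I where "I = insert (0::rat, {}, {})
    {(q, U, V). U \<in> B0 \<and> V \<in> B1 \<and> (\<forall>p\<in>U \<times> V. ennreal (real_of_rat q) \<le> c p)}"
  have "I \<subseteq> insert (0, {}, {}) (UNIV \<times> (B0 \<times> B1))" by (auto simp: I_def)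
  then have "countable I"
    using B0(1) B1(1) by (meson countable_SIGMA countable_insert countable_subset countableI_type)
  moreover have "I \<noteq> {}" by (simp add: I_def)
  ultimately obtain f :: "nat \<Rightarrow> _" where f: "I = range f"
    using uncountable_def by blast
  define r where "r i = ennreal (real_of_rat (fst (f i)))" for i
  define U where "U i = fst (snd (f i))" for i
  define V where "V i = snd (snd (f i))" for i
  have fI: "(fst (f i), U i, V i) \<in> I" for i by (auto simp: f U_def V_def)
  have le: "r i * indicator (U i \<times> V i) p \<le> c p" for i p
    using fI[of i] by (auto simp: I_def r_def indicator_def)
  have "c p = (SUP i. r i * indicator (U i \<times> V i) p)" for p
  proof (rule antisym)
    show "(SUP i. r i * indicator (U i \<times> V i) p) \<le> c p" using le by (rule SUP_least)
    show "c p \<le> (SUP i. r i * indicator (U i \<times> V i) p)"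
    proof (rule ccontr)
      assume "\<not> ?thesis"
      then have "(SUP i. r i * indicator (U i \<times> V i) p) < c p" by simp
      then obtain q where q: "(SUP i. r i * indicator (U i \<times> V i) p) < ennreal (real_of_rat q)"
        "ennreal (real_of_rat q) < c p"
        using ennreal_rat_dense by blast
      have "p \<in> {p. ennreal (real_of_rat q) < c p}" using q(2) by simp
      then obtain W where W: "W \<in> (\<lambda>(a, b). a \<times> b) ` (B0 \<times> B1)" "p \<in> W"
        "W \<subseteq> {p. ennreal (real_of_rat q) < c p}"
        using topological_basisE[OF topological_basis_prod[OF B0(2) B1(2)] lsc] by blast
      then obtain a b where ab: "a \<in> B0" "b \<in> B1" "W = a \<times> b" by auto
      have "(q, a, b) \<in> I" using W(3) ab by (auto simp: I_def dest!: subsetD)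
      then obtain i where "f i = (q, a, b)" unfolding f by (metis rangeE)
      then have "ennreal (real_of_rat q) = r i * indicator (U i \<times> V i) p"
        using W(2) ab(3) by (simp add: r_def U_def V_def)
      also have "\<dots> \<le> (SUP i. r i * indicator (U i \<times> V i) p)" by (rule SUP_upper) simp
      finally show False using q(1) by simp
    qed
  qed
  moreover have "open (U i)" "open (V i)" for i
    using fI[of i] topological_basis_open[OF B0(2)] topological_basis_open[OF B1(2)] by (auto simp: I_def)
  moreover have "r i \<noteq> \<top>" for i by (simp add: r_def)
  ultimately show thesis using that by blast
qed

theorem exists_optimal_coupling:
  fixes \<Omega>0 :: "'a::polish_space set" and \<Omega>1 :: "'b::polish_space set" and c :: "'a \<times> 'b \<Rightarrow> ennreal"
  assumes \<Omega>: "\<Omega>0 \<in> sets borel" "\<Omega>1 \<in> sets borel"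
    and M0: "M0 \<in> prob_measures (borel_on \<Omega>0)" and M1: "M1 \<in> prob_measures (borel_on \<Omega>1)"
    and lsc: "\<And>t. open {p. t < c p}"
  obtains \<gamma> where "\<gamma> \<in> couplings M0 M1"
    "\<And>\<gamma>'. \<gamma>' \<in> couplings M0 M1 \<Longrightarrow> (\<integral>\<^sup>+p. c p \<partial>\<gamma>) \<le> (\<integral>\<^sup>+p. c p \<partial>\<gamma>')"
proof -
  let ?N = "M0 \<Otimes>\<^sub>M M1" and ?P = "couplings M0 M1" and ?I = "\<lambda>\<gamma>. \<integral>\<^sup>+p. c p \<partial>\<gamma>"
  let ?R = "approximable_algebra ?N ?P"
  have s: "sets M0 = sets (borel_on \<Omega>0)" "sets M1 = sets (borel_on \<Omega>1)" "prob_space M0" "prob_space M1"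
    using M0 M1 by (auto simp: prob_measures_def)
  have sp: "space M0 = \<Omega>0" "space M1 = \<Omega>1"
    using s(1,2)[THEN sets_eq_imp_space_eq] by (auto simp: space_restrict_space)
  have rect: "A \<times> B \<in> ?R" if "A \<in> sets M0" "B \<in> sets M1" for A B
    using that \<Omega> M0 M1 by (intro Times_in_approximable_algebra compactly_approximable_borel)
  have P: "?P \<subseteq> prob_measures ?N" by (auto simp: couplings_def)
  have "space ?N \<in> ?R" using rect[OF sets.top sets.top] by (simp add: space_pair_measure)
  then have top: "compactly_approximable ?N ?P (space ?N)" by (simp add: approximable_algebra_def)
  have gen: "sets ?N \<subseteq> sigma_sets (space ?N) ?R"
    unfolding sets_pair_measure space_pair_measure using rect by (intro sigma_sets_mono') auto
  have "?P \<noteq> {}" using pair_measure_in_couplings[OF s(3,4)] by auto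
  then obtain f where f: "decseq f" "range f \<subseteq> ?I ` ?P" "Inf (?I ` ?P) = (INF i. f i)"
    using ennreal_Inf_countable_INF[of "?I ` ?P"] by auto
  then have "\<forall>i. \<exists>\<gamma>\<in>?P. f i = ?I \<gamma>" by auto
  then obtain m where m: "\<And>i. m i \<in> ?P" "\<And>i. f i = ?I (m i)" by metis
  obtain G \<mu> where G: "G \<noteq> bot" "G \<le> sequentially" and \<mu>: "\<mu> \<in> prob_measures ?N"
    and lim: "\<And>E. E \<in> ?R \<Longrightarrow> ((\<lambda>n. measure (m n) E) \<longlongrightarrow> measure \<mu> E) G"
    by (rule cluster_measure[OF P top gen, of m]) (rule m(1), blast)
  have \<mu>s: "sets \<mu> = sets ?N" "prob_space \<mu>" using \<mu> by (auto simp: prob_measures_def)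
  note fm = prob_space.finite_measure[THEN finite_measure.emeasure_eq_measure]
  \<comment> \<open>The marginals survive the limit, since cylinders over measurable sets are rectangles.\<close>
  have "\<mu> \<in> ?P"
  proof (rule couplingsI[OF \<mu>s(2,1)])
    fix A assume A: "A \<in> sets M0"
    have "measure (m n) (A \<times> space M1) = measure M0 A" for n
      using couplingsD(4)[OF m(1) A] by (simp add: measure_def)
    then have "measure \<mu> (A \<times> space M1) = measure M0 A"
      using lim[OF rect[OF A sets.top]] by (simp add: tendsto_const_iff[OF G(1)])
    then show "emeasure \<mu> (A \<times> space M1) = emeasure M0 A"
      by (simp add: fm[OF \<mu>s(2)] fm[OF s(3)])
  next
    fix B assume B: "B \<in> sets M1"
    have "measure (m n) (space M0 \<times> B) = measure M1 B" for n
      using couplingsD(5)[OF m(1) B] by (simp add: measure_def)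
    then have "measure \<mu> (space M0 \<times> B) = measure M1 B"
      using lim[OF rect[OF sets.top B]] by (simp add: tendsto_const_iff[OF G(1)])
    then show "emeasure \<mu> (space M0 \<times> B) = emeasure M1 B"
      by (simp add: fm[OF \<mu>s(2)] fm[OF s(4)])
  qed
  moreover have "?I \<mu> \<le> Inf (?I ` ?P)"
  proof -
    obtain r :: "nat \<Rightarrow> ennreal" and U V where r: "\<And>i. r i \<noteq> \<top>" and UV: "\<And>i. open (U i)" "\<And>i. open (V i)"
      and c: "\<And>p. c p = (SUP i. r i * indicator (U i \<times> V i) p)"
      by (rule lower_semicontinuous_SUP_rectangles[OF lsc]) blast
    let ?S = "\<lambda>i. (U i \<inter> \<Omega>0) \<times> (V i \<inter> \<Omega>1)"
    have "U i \<inter> \<Omega>0 \<in> sets M0" "V i \<inter> \<Omega>1 \<in> sets M1" for i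
      using UV[of i] \<Omega> by (simp_all add: s(1,2) sets_restrict_space_iff borel_open)
    then have S: "?S i \<in> ?R" for i by (rule rect)
    have "f \<longlonglongrightarrow> Inf (?I ` ?P)" unfolding f(3) by (rule LIMSEQ_INF[OF f(1)])
    then have v: "((\<lambda>n. ?I (m n)) \<longlongrightarrow> Inf (?I ` ?P)) G"
      unfolding m(2)[symmetric] by (rule tendsto_mono[OF G(2)])
    have mN: "m n \<in> prob_measures ?N" for n using m(1) P by blast
    have "c p = (SUP i. r i * indicator (?S i) p)" if "p \<in> space ?N" for p
      unfolding c using that sp by (intro SUP_cong) (auto simp: space_pair_measure indicator_def)
    from nn_integral_SUP_indicator_le_lim[OF algebra_approximable_algebra[OF P top] _ mN \<mu> lim G(1) S r this v]
    show ?thesis by (auto simp: approximable_algebra_def compactly_approximable_def)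
  qed
  then have "?I \<mu> \<le> ?I \<gamma>'" if "\<gamma>' \<in> ?P" for \<gamma>'
    by (rule order_trans) (rule INF_lower[OF that])
  ultimately show thesis by (rule that)
qed

section \<open>The functions in MI\<close>

lemma MI_facts:
  assumes "\<phi> \<in> MI"
  shows MI_nonneg: "x \<ge> 0 \<Longrightarrow> \<phi> x \<ge> 0"
    and MI_inv_nonneg: "x \<ge> 0 \<Longrightarrow> inv_into {0..} \<phi> x \<ge> 0"
    and MI_inv_right: "x \<ge> 0 \<Longrightarrow> \<phi> (inv_into {0..} \<phi> x) = x"
    and MI_inv_left: "x \<ge> 0 \<Longrightarrow> inv_into {0..} \<phi> (\<phi> x) = x"
    and MI_mono: "0 \<le> x \<Longrightarrow> x \<le> y \<Longrightarrow> \<phi> x \<le> \<phi> y"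
    and MI_less_iff: "x \<ge> 0 \<Longrightarrow> y \<ge> 0 \<Longrightarrow> x < \<phi> y \<longleftrightarrow> inv_into {0..} \<phi> x < y"
proof -
  have b: "bij_betw \<phi> {0..} {0..}" and m: "mono_on {0..} \<phi>"
    using assms by (auto simp: MI_def)
  show nonneg: "\<phi> x \<ge> 0" if "x \<ge> 0" for x using b that by (auto simp: bij_betw_def)
  show inonneg: "inv_into {0..} \<phi> x \<ge> 0" if "x \<ge> 0" for x
    using b that inv_into_into[of x \<phi> "{0..}"] by (auto simp: bij_betw_def)
  show r: "\<phi> (inv_into {0..} \<phi> x) = x" if "x \<ge> 0" for x
    using b that f_inv_into_f[of x \<phi> "{0..}"] by (auto simp: bij_betw_def)
  show "inv_into {0..} \<phi> (\<phi> x) = x" if "x \<ge> 0" for x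
    using b that by (auto simp: bij_betw_def)
  show mono: "\<phi> x \<le> \<phi> y" if "0 \<le> x" "x \<le> y" for x y
    using m that by (auto simp: mono_on_def)
  show "x < \<phi> y \<longleftrightarrow> inv_into {0..} \<phi> x < y" if "x \<ge> 0" "y \<ge> 0" for x y
  proof -
    have "\<phi> (inv_into {0..} \<phi> x) < \<phi> y \<longleftrightarrow> inv_into {0..} \<phi> x < y"
      using mono inonneg[OF that(1)] that(2) b
      by (smt (verit) atLeast_iff bij_betw_imp_inj_on inj_on_eq_iff)
    then show ?thesis using r[OF that(1)] by simp
  qed
qed

lemma extend_top_ext_inv:
  assumes "\<phi> \<in> MI"
  shows "extend_top \<phi> (ext_inv \<phi> c) = c"
  by (cases c) (auto simp: extend_top_def MI_inv_nonneg[OF assms] MI_inv_right[OF assms])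

text \<open>Concavity of \<open>F\<close> on the segment from \<open>(0, 0)\<close> to \<open>(s, s)\<close> bounds \<open>F (s, s)\<close>, which is
  \<open>\<phi> (2 * \<psi> s)\<close>, linearly in \<open>s\<close>.  This doubling property stands in for the triangle inequality when
  costs are to be shown finite.\<close>

lemma MI_doubling:
  assumes \<phi>: "\<phi> \<in> MI"
  obtains C where "C \<ge> 0" "\<And>a b. a \<ge> 0 \<Longrightarrow> b \<ge> 0 \<Longrightarrow> \<phi> (a + b) \<le> C * (1 + \<phi> a + \<phi> b)"
proof -
  let ?\<psi> = "inv_into {0..} \<phi>"
  let ?F = "\<lambda>(x0, x1). \<phi> (?\<psi> x0 + ?\<psi> x1)"
  define C where "C = \<phi> (2 * ?\<psi> 1)"
  have psi: "?\<psi> x \<ge> 0" if "x \<ge> 0" for x by (rule MI_inv_nonneg[OF \<phi> that])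
  have C: "C \<ge> 0" unfolding C_def using psi by (intro MI_nonneg[OF \<phi>]) auto
  have F: "concave_on ({0..} \<times> {0..}) ?F" using \<phi> by (auto simp: MI_def)
  have con: "u * ?F x + v * ?F y \<le> ?F (u *\<^sub>R x + v *\<^sub>R y)"
    if "x \<in> {0..} \<times> {0..}" "y \<in> {0..} \<times> {0..}" "0 \<le> u" "0 \<le> v" "u + v = 1" for x y u v
    using F that unfolding concave_on_iff by blast
  have dbl: "\<phi> (2 * a) \<le> C * (1 + \<phi> a)" if a: "a \<ge> 0" for a
  proof (cases "\<phi> a \<le> 1")
    case True
    then have "a \<le> ?\<psi> 1"
      using MI_less_iff[OF \<phi>, of 1 a] a by auto
    then have "\<phi> (2 * a) \<le> C" unfolding C_def using a by (intro MI_mono[OF \<phi>]) auto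
    also have "\<dots> \<le> C * (1 + \<phi> a)" using C MI_nonneg[OF \<phi> a] by (simp add: algebra_simps)
    finally show ?thesis .
  next
    case False
    define s where "s = \<phi> a"
    have s: "s > 1" using False by (simp add: s_def)
    \<comment> \<open>The point \<open>(1, 1)\<close> divides the segment from \<open>(0, 0)\<close> to \<open>(s, s)\<close>.\<close>
    have "(1/s) * ?F (s, s) + (1 - 1/s) * ?F (0, 0) \<le> ?F ((1/s) *\<^sub>R (s, s) + (1 - 1/s) *\<^sub>R (0, 0))"
      using s by (intro con) (auto simp: divide_le_eq)
    moreover have "?F (0, 0) \<ge> 0" using psi[of 0] by (auto intro: MI_nonneg[OF \<phi>])
    moreover have "(1/s) *\<^sub>R (s, s) + (1 - 1/s) *\<^sub>R (0, 0) = (1::real, 1::real)"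
      using s by simp
    ultimately have "(1/s) * ?F (s, s) \<le> ?F (1, 1)"
      using s by (smt (verit) divide_le_eq_1 mult_nonneg_nonneg)
    then have "?F (s, s) \<le> s * C" using s by (simp add: C_def field_simps)
    moreover have "?\<psi> s = a" unfolding s_def by (rule MI_inv_left[OF \<phi> a])
    ultimately have "\<phi> (2 * a) \<le> C * \<phi> a" by (simp add: s_def algebra_simps)
    then show ?thesis using C by (simp add: algebra_simps)
  qed
  have "\<phi> (a + b) \<le> C * (1 + \<phi> a + \<phi> b)" if "a \<ge> 0" "b \<ge> 0" for a b
  proof -
    have "\<phi> (a + b) \<le> \<phi> (2 * max a b)" using that by (intro MI_mono[OF \<phi>]) auto
    also have "\<dots> \<le> C * (1 + \<phi> (max a b))" using that by (intro dbl) auto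
    also have "\<dots> \<le> C * (1 + \<phi> a + \<phi> b)"
      using C MI_nonneg[OF \<phi>] that by (intro mult_left_mono) (auto simp: max_def)
    finally show ?thesis .
  qed
  with C show thesis by (rule that)
qed

text \<open>An increasing bijection satisfies \<open>r < \<phi> x\<close> iff \<open>\<psi> r < x\<close>, where \<open>\<psi>\<close> is its inverse; this gives
  lower semicontinuity and measurability of the cost directly.\<close>

lemma open_MI_greater:
  fixes f :: "'b::topological_space \<Rightarrow> real"
  assumes \<phi>: "\<phi> \<in> MI" and f: "continuous_on UNIV f" "\<And>p. f p \<ge> 0"
  shows "open {p. t < ennreal (\<phi> (f p))}"
proof (cases t)
  case (real r)
  have "t < ennreal (\<phi> (f p)) \<longleftrightarrow> inv_into {0..} \<phi> r < f p" for p
    using real MI_less_iff[OF \<phi> real(1) f(2), of p] by (simp add: ennreal_less_iff)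
  then show ?thesis using f(1) by (simp add: open_Collect_less continuous_on_const)
qed simp

lemma borel_measurable_MI:
  fixes f :: "'b::topological_space \<Rightarrow> real"
  assumes "\<phi> \<in> MI" "continuous_on UNIV f" "\<And>p. f p \<ge> 0"
  shows "(\<lambda>p. ennreal (\<phi> (f p))) \<in> borel_measurable borel"
  by (rule borel_measurableI_greater) (simp add: borel_open[OF open_MI_greater[OF assms]])

lemma borel_measurable_cost:
  fixes \<Omega> :: "'a::polish_space set"
  assumes \<phi>: "\<phi> \<in> MI"
  shows "(\<lambda>(x, y). ennreal (\<phi> (dist x y))) \<in> borel_measurable (borel_on \<Omega> \<Otimes>\<^sub>M borel_on \<Omega>)"
proof -
  have c: "(\<lambda>p::'a \<times> 'a. ennreal (\<phi> (dist (fst p) (snd p)))) \<in> borel_measurable (borel \<Otimes>\<^sub>M borel)"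
    unfolding borel_prod by (intro borel_measurable_MI[OF \<phi>]) (auto intro!: continuous_intros)
  have "(\<lambda>x. x) \<in> measurable (borel_on \<Omega>) borel"
    by (intro measurable_restrict_space1 measurable_ident_sets) simp
  then have "(\<lambda>p. (fst p, snd p)) \<in> measurable (borel_on \<Omega> \<Otimes>\<^sub>M borel_on \<Omega>) (borel \<Otimes>\<^sub>M borel)"
    by (intro measurable_Pair measurable_compose[OF measurable_fst] measurable_compose[OF measurable_snd])
  from measurable_compose[OF this c] show ?thesis by (simp add: case_prod_beta)
qed

lemma nn_integral_marginals:
  assumes \<gamma>: "\<gamma> \<in> couplings M0 M1"
  shows "f \<in> borel_measurable M0 \<Longrightarrow> (\<integral>\<^sup>+p. f (fst p) \<partial>\<gamma>) = (\<integral>\<^sup>+x. f x \<partial>M0)"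
    and "g \<in> borel_measurable M1 \<Longrightarrow> (\<integral>\<^sup>+p. g (snd p) \<partial>\<gamma>) = (\<integral>\<^sup>+x. g x \<partial>M1)"
proof -
  have m: "fst \<in> measurable \<gamma> M0" "snd \<in> measurable \<gamma> M1"
    by (simp_all add: measurable_cong_sets[OF couplingsD(2)[OF \<gamma>] refl])
  have d: "distr \<gamma> M0 fst = M0" "distr \<gamma> M1 snd = M1" using \<gamma> by (auto simp: couplings_def)
  show "f \<in> borel_measurable M0 \<Longrightarrow> (\<integral>\<^sup>+p. f (fst p) \<partial>\<gamma>) = (\<integral>\<^sup>+x. f x \<partial>M0)"
    using nn_integral_distr[OF m(1), of f] d by simp
  show "g \<in> borel_measurable M1 \<Longrightarrow> (\<integral>\<^sup>+p. g (snd p) \<partial>\<gamma>) = (\<integral>\<^sup>+x. g x \<partial>M1)"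
    using nn_integral_distr[OF m(2), of g] d by simp
qed

text \<open>Every coupling, not only an optimal one: the distance of \<open>x0\<close> and \<open>x1\<close> is estimated through the
  base points \<open>y0\<close> and \<open>y1\<close>, which may differ, and after two applications of the doubling property each term
  depends on a single marginal.\<close>

lemma cost_finite:
  fixes \<Omega> :: "'a::polish_space set"
  assumes \<phi>: "\<phi> \<in> MI" and M: "M0 \<in> P_phi \<phi> \<Omega>" "M1 \<in> P_phi \<phi> \<Omega>" and \<gamma>: "\<gamma> \<in> couplings M0 M1"
  shows "cost \<phi> \<gamma> < \<top>"
proof -
  let ?c = "\<lambda>y x. ennreal (\<phi> (dist x y))"
  obtain y0 where y0: "(\<integral>\<^sup>+x. ?c y0 x \<partial>M0) < \<infinity>" using M(1) by (auto simp: P_phi_def)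
  obtain y1 where y1: "(\<integral>\<^sup>+x. ?c y1 x \<partial>M1) < \<infinity>" using M(2) by (auto simp: P_phi_def)
  have sM: "sets M0 = sets (borel_on \<Omega>)" "sets M1 = sets (borel_on \<Omega>)"
    using M by (auto simp: P_phi_def prob_measures_def)
  interpret \<gamma>: prob_space \<gamma> by (rule couplingsD(1)[OF \<gamma>])
  obtain C where C: "C \<ge> 0" "\<And>a b. a \<ge> 0 \<Longrightarrow> b \<ge> 0 \<Longrightarrow> \<phi> (a + b) \<le> C * (1 + \<phi> a + \<phi> b)"
    using MI_doubling[OF \<phi>] by blast
  note nn = MI_nonneg[OF \<phi>]
  define D where "D = C * (1 + C * (1 + \<phi> (dist y0 y1)))"
  have D: "D \<ge> 0" using C(1) nn[of "dist y0 y1"] by (simp add: D_def)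
  have bound: "ennreal (\<phi> (dist x0 x1)) \<le> ennreal D + ennreal C * ?c y0 x0 + ennreal (C * C) * ?c y1 x1" for x0 x1
  proof -
    have "\<phi> (dist x0 x1) \<le> \<phi> (dist x0 y0 + (dist y0 y1 + dist x1 y1))"
      by (intro MI_mono[OF \<phi>]) (auto, metric)
    also have "\<dots> \<le> C * (1 + \<phi> (dist x0 y0) + \<phi> (dist y0 y1 + dist x1 y1))"
      by (intro C(2)) auto
    also have "\<dots> \<le> C * (1 + \<phi> (dist x0 y0) + C * (1 + \<phi> (dist y0 y1) + \<phi> (dist x1 y1)))"
      using C by (intro mult_left_mono add_left_mono) auto
    also have "\<dots> = D + C * \<phi> (dist x0 y0) + C * C * \<phi> (dist x1 y1)"
      by (simp add: D_def algebra_simps)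
    finally show ?thesis
      using C(1) D nn by (simp add: ennreal_mult[symmetric] ennreal_plus[symmetric] ennreal_leI del: ennreal_plus)
  qed
  have mc: "?c y \<in> borel_measurable (borel_on \<Omega>)" for y
    by (rule measurable_restrict_space1, rule borel_measurable_MI[OF \<phi>]) (auto intro!: continuous_intros)
  then have mc0: "?c y \<in> borel_measurable M0" "?c y \<in> borel_measurable M1" for y
    by (simp_all add: measurable_cong_sets[OF sM(1) refl] measurable_cong_sets[OF sM(2) refl])
  have mf: "(\<lambda>p. ?c y0 (fst p)) \<in> borel_measurable \<gamma>" "(\<lambda>p. ?c y1 (snd p)) \<in> borel_measurable \<gamma>"
    using mc0 by (simp_all add: measurable_cong_sets[OF couplingsD(2)[OF \<gamma>] refl]
        measurable_compose[OF measurable_fst] measurable_compose[OF measurable_snd])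
  have "cost \<phi> \<gamma> \<le> (\<integral>\<^sup>+p. ennreal D + ennreal C * ?c y0 (fst p) + ennreal (C * C) * ?c y1 (snd p) \<partial>\<gamma>)"
    unfolding cost_def using bound by (intro nn_integral_mono) (auto simp: case_prod_beta)
  also have "\<dots> = ennreal D + ennreal C * (\<integral>\<^sup>+p. ?c y0 (fst p) \<partial>\<gamma>)
      + ennreal (C * C) * (\<integral>\<^sup>+p. ?c y1 (snd p) \<partial>\<gamma>)"
    using mf by (simp add: nn_integral_add nn_integral_cmult \<gamma>.emeasure_space_1)
  also have "\<dots> < \<top>"
    using y0 y1 nn_integral_marginals(1)[OF \<gamma> mc0(1)] nn_integral_marginals(2)[OF \<gamma> mc0(2)]
    by (simp add: ennreal_mult_less_top)
  finally show ?thesis .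
qed

section \<open>Weighted sums of measures and identifiability\<close>

lemma nn_integral_weighted_sum:
  assumes fin: "finite I" and m: "\<And>i. i \<in> I \<Longrightarrow> sets (m i) = sets M" and f: "f \<in> borel_measurable M"
  shows "(\<integral>\<^sup>+x. f x \<partial>weighted_sum M I l m) = (\<Sum>i\<in>I. ennreal (l i) * (\<integral>\<^sup>+x. f x \<partial>m i))"
proof -
  have sp: "space (m i) = space M" if "i \<in> I" for i using sets_eq_imp_space_eq[OF m[OF that]] .
  have spw: "space (weighted_sum M I l m) = space M" by (rule sets_eq_imp_space_eq) simp
  have mw: "borel_measurable (weighted_sum M I l m) = (borel_measurable M :: (_ \<Rightarrow> ennreal) set)"
    by (rule measurable_cong_sets) auto
  have mm: "g \<in> borel_measurable (m i)" if "i \<in> I" "g \<in> borel_measurable M" for i and g :: "_ \<Rightarrow> ennreal"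
    using that measurable_cong_sets[OF m[OF that(1)] refl] by blast
  show ?thesis using f
  proof (induction rule: borel_measurable_induct)
    case (cong f g)
    then show ?case using sp spw
      by (metis (no_types, lifting) nn_integral_cong sum.cong)
  next
    case (set B)
    then show ?case using emeasure_weighted_sum[OF fin m set] m by (simp add: nn_integral_indicator)
  next
    case (mult u c)
    then show ?case using mm mw
      by (simp add: nn_integral_cmult sum_distrib_left mult.left_commute)
  next
    case (add u v)
    then show ?case using mm mw
      by (simp add: nn_integral_add sum.distrib distrib_left)
  next
    case (seq U)
    have "(\<integral>\<^sup>+x. (SUP i. U i) x \<partial>N) = (SUP i. \<integral>\<^sup>+x. U i x \<partial>N)" if "\<And>i. U i \<in> borel_measurable N" for N
      using nn_integral_monotone_convergence_SUP[OF seq(3) that] by (simp add: image_image)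
    note S = this
    have inc: "incseq (\<lambda>k. ennreal (l i) * (\<integral>\<^sup>+x. U k x \<partial>m i))" for i
      using seq(3) by (intro monoI mult_left_mono nn_integral_mono) (auto simp: mono_def le_fun_def)
    have "(\<integral>\<^sup>+x. (SUP i. U i) x \<partial>weighted_sum M I l m)
        = (SUP k. \<Sum>i\<in>I. ennreal (l i) * (\<integral>\<^sup>+x. U k x \<partial>m i))"
      using S seq mw by simp
    also have "\<dots> = (\<Sum>i\<in>I. SUP k. ennreal (l i) * (\<integral>\<^sup>+x. U k x \<partial>m i))"
      using inc by (intro ennreal_SUP_sum)
    also have "\<dots> = (\<Sum>i\<in>I. ennreal (l i) * (\<integral>\<^sup>+x. (SUP i. U i) x \<partial>m i))"
    proof (rule sum.cong[OF refl])
      fix i assume i: "i \<in> I"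
      show "(SUP k. ennreal (l i) * (\<integral>\<^sup>+x. U k x \<partial>m i)) = ennreal (l i) * (\<integral>\<^sup>+x. (SUP i. U i) x \<partial>m i)"
        unfolding S[OF mm[OF i seq(1)]] by (rule SUP_mult_left_ennreal[symmetric])
    qed
    finally show ?case .
  qed
qed

lemma minimizers_iff:
  fixes f :: "'b \<Rightarrow> 'c::linorder"
  shows "x \<in> minimizers f S \<longleftrightarrow> x \<in> S \<and> (\<forall>y\<in>S. f x \<le> f y)"
  by (auto simp: minimizers_def is_arg_min_def not_less)

lemma space_weighted_sum [simp]: "space (weighted_sum M I l m) = space M"
  by (rule sets_eq_imp_space_eq) simp

text \<open>The atoms of a mixture may be listed repeatedly and with weight zero; over an
  identifiable dictionary, the total weight of an atom depends on the mixture only.\<close>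

definition atom_weight :: "nat \<Rightarrow> (nat \<Rightarrow> real) \<Rightarrow> (nat \<Rightarrow> 'a) \<Rightarrow> 'a \<Rightarrow> real" where
  "atom_weight J l m a = (\<Sum>j\<in>{j\<in>{1..J}. m j = a}. l j)"

lemma simplex_weightsD:
  assumes "l \<in> simplex_weights J"
  shows "j \<in> {1..J} \<Longrightarrow> l j \<ge> 0" "(\<Sum>j\<in>{1..J}. l j) = 1"
  using assms by (auto simp: simplex_weights_def)

lemma simplex_weightsI:
  assumes nn: "\<And>j. j \<in> {1..J} \<Longrightarrow> l j \<ge> 0" and s: "(\<Sum>j\<in>{1..J}. l j) = 1"
  shows "l \<in> simplex_weights J"
proof -
  have "l j \<le> 1" if "j \<in> {1..J}" for j
    using member_le_sum[of j "{1..J}" l] nn that s by auto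
  then show ?thesis using nn s by (auto simp: simplex_weights_def)
qed

lemma atom_weight_nonneg: "l \<in> simplex_weights J \<Longrightarrow> atom_weight J l m a \<ge> 0"
  unfolding atom_weight_def by (intro sum_nonneg) (auto dest: simplex_weightsD)

lemma atom_weight_ge: "l \<in> simplex_weights J \<Longrightarrow> j \<in> {1..J} \<Longrightarrow> l j \<le> atom_weight J l m (m j)"
  unfolding atom_weight_def by (intro member_le_sum) (auto dest: simplex_weightsD)

text \<open>Brings a mixture into the form to which the definition of identifiability applies: distinct
  atoms with positive weights.\<close>

lemma mixture_collect_atoms:
  assumes J: "J \<ge> 1" and l: "l \<in> simplex_weights J"
    and m: "\<And>j. j \<in> {1..J} \<Longrightarrow> sets (m j) = sets M"
  obtains K h where "K \<ge> 1" "inj_on h {1..K}" "h ` {1..K} = {a. atom_weight J l m a > 0}"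
    "(\<lambda>k. atom_weight J l m (h k)) \<in> simplex_weights K"
    "mixture M K (\<lambda>k. atom_weight J l m (h k)) h = mixture M J l m"
    "h ` {1..K} \<subseteq> m ` {1..J}"
proof -
  let ?W = "atom_weight J l m"
  define S where "S = {a. ?W a > 0}"
  have W0: "?W a = 0" if "a \<notin> m ` {1..J}" for a
  proof -
    have "{j \<in> {1..J}. m j = a} = {}" using that by auto
    then show ?thesis by (simp only: atom_weight_def sum.empty)
  qed
  then have sub: "S \<subseteq> m ` {1..J}" by (force simp: S_def)
  then have fin: "finite S" by (rule finite_subset) simp
  have Wnn: "?W a \<ge> 0" for a by (rule atom_weight_nonneg[OF l])
  have Sc: "?W a = 0" if "a \<notin> S" for a using that Wnn[of a] by (auto simp: S_def)
  have tot: "(\<Sum>a\<in>S. ?W a) = 1"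
  proof -
    have "(\<Sum>a\<in>S. ?W a) = (\<Sum>a\<in>m ` {1..J}. ?W a)"
      using sub Sc by (intro sum.mono_neutral_left) auto
    also have "\<dots> = (\<Sum>j\<in>{1..J}. l j)"
      unfolding atom_weight_def by (rule sum.image_gen[symmetric]) simp
    finally show ?thesis using simplex_weightsD(2)[OF l] by simp
  qed
  obtain h where h: "bij_betw h {1..card S} S" using ex_bij_betw_nat_finite_1[OF fin] by blast
  have hS: "h ` {1..card S} = S" and hi: "inj_on h {1..card S}" using h by (auto simp: bij_betw_def)
  have "card S \<ge> 1" using tot fin by (cases "card S") auto
  moreover have "(\<lambda>k. ?W (h k)) \<in> simplex_weights (card S)"
    using Wnn tot sum.reindex_bij_betw[OF h, of ?W] by (intro simplex_weightsI) auto
  moreover have "mixture M (card S) (\<lambda>k. ?W (h k)) h = mixture M J l m"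
  proof (rule measure_eqI)
    fix B assume "B \<in> sets (mixture M (card S) (\<lambda>k. ?W (h k)) h)"
    then have B: "B \<in> sets M" by simp
    have hm: "sets (h k) = sets M" if "k \<in> {1..card S}" for k
      using that m hS sub by (metis image_eqI imageE subsetD)
    have "emeasure (mixture M (card S) (\<lambda>k. ?W (h k)) h) B = (\<Sum>k\<in>{1..card S}. ennreal (?W (h k)) * emeasure (h k) B)"
      using hm B by (intro emeasure_weighted_sum) auto
    also have "\<dots> = (\<Sum>a\<in>S. ennreal (?W a) * emeasure a B)"
      by (rule sum.reindex_bij_betw[OF h, of "\<lambda>a. ennreal (?W a) * emeasure a B"])
    also have "\<dots> = (\<Sum>a\<in>m ` {1..J}. ennreal (?W a) * emeasure a B)"
      using sub Sc by (intro sum.mono_neutral_left) auto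
    also have "\<dots> = (\<Sum>a\<in>m ` {1..J}. \<Sum>j\<in>{j\<in>{1..J}. m j = a}. ennreal (l j) * emeasure (m j) B)"
    proof (rule sum.cong[OF refl])
      fix a
      have "ennreal (?W a) = (\<Sum>j\<in>{j\<in>{1..J}. m j = a}. ennreal (l j))"
        unfolding atom_weight_def using simplex_weightsD(1)[OF l] by (intro sum_ennreal[symmetric]) auto
      then show "ennreal (?W a) * emeasure a B = (\<Sum>j\<in>{j\<in>{1..J}. m j = a}. ennreal (l j) * emeasure (m j) B)"
        by (simp add: sum_distrib_right)
    qed
    also have "\<dots> = (\<Sum>j\<in>{1..J}. ennreal (l j) * emeasure (m j) B)"
      by (rule sum.image_gen[symmetric]) simp
    also have "\<dots> = emeasure (mixture M J l m) B"
      using m B by (intro emeasure_weighted_sum[symmetric]) auto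
    finally show "emeasure (mixture M (card S) (\<lambda>k. ?W (h k)) h) B = emeasure (mixture M J l m) B" .
  qed simp
  ultimately show thesis using that[of "card S" h] hi hS sub by (simp add: S_def)
qed

text \<open>Identifiability for arbitrary listings: two of them give the same mixture only if each atom has
  the same total weight in both.\<close>

lemma identifiable_atom_weight_eq:
  assumes id: "identifiable M A" and A: "A \<subseteq> prob_measures M"
    and J: "J \<ge> 1" "J' \<ge> 1" and l: "l \<in> simplex_weights J" "l' \<in> simplex_weights J'"
    and m: "m ` {1..J} \<subseteq> A" "m' ` {1..J'} \<subseteq> A"
    and eq: "mixture M J l m = mixture M J' l' m'"
  shows "atom_weight J l m a = atom_weight J' l' m' a"
proof -
  let ?W = "atom_weight J l m" and ?W' = "atom_weight J' l' m'"
  have s: "sets x = sets M" if "x \<in> A" for x using A that by (auto simp: prob_measures_def)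
  have sm: "sets (m j) = sets M" if "j \<in> {1..J}" for j using m(1) s that by blast
  have sm': "sets (m' j) = sets M" if "j \<in> {1..J'}" for j using m(2) s that by blast
  obtain K h where h: "K \<ge> 1" "inj_on h {1..K}" "h ` {1..K} = {a. ?W a > 0}"
    "(\<lambda>k. ?W (h k)) \<in> simplex_weights K" "mixture M K (\<lambda>k. ?W (h k)) h = mixture M J l m"
    "h ` {1..K} \<subseteq> m ` {1..J}"
    by (rule mixture_collect_atoms[OF J(1) l(1) sm])
  obtain K' h' where h': "K' \<ge> 1" "inj_on h' {1..K'}" "h' ` {1..K'} = {a. ?W' a > 0}"
    "(\<lambda>k. ?W' (h' k)) \<in> simplex_weights K'" "mixture M K' (\<lambda>k. ?W' (h' k)) h' = mixture M J' l' m'"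
    "h' ` {1..K'} \<subseteq> m' ` {1..J'}"
    by (rule mixture_collect_atoms[OF J(2) l(2) sm'])
  have pos: "\<forall>k\<in>{1..K}. ?W (h k) > 0" "\<forall>k\<in>{1..K'}. ?W' (h' k) > 0"
    using h(3) h'(3) by blast+
  have hA: "h ` {1..K} \<subseteq> A" "h' ` {1..K'} \<subseteq> A" using h(6) h'(6) m by blast+
  have "mixture M K (\<lambda>k. ?W (h k)) h = mixture M K' (\<lambda>k. ?W' (h' k)) h' \<longleftrightarrow>
      K = K' \<and> (\<exists>\<sigma>. bij_betw \<sigma> {1..K} {1..K'} \<and>
        (\<forall>k\<in>{1..K}. ?W (h k) = ?W' (h' (\<sigma> k)) \<and> h k = h' (\<sigma> k)))"
    by (rule id[unfolded identifiable_def, rule_format]) (intro conjI h(1,2,4) h'(1,2,4) pos hA)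
  then have "\<exists>\<sigma>. bij_betw \<sigma> {1..K} {1..K'} \<and> (\<forall>k\<in>{1..K}. ?W (h k) = ?W' (h' (\<sigma> k)) \<and> h k = h' (\<sigma> k))"
    unfolding h(5) h'(5) eq by blast
  then obtain \<sigma> where \<sigma>: "bij_betw \<sigma> {1..K} {1..K'}"
    "\<And>k. k \<in> {1..K} \<Longrightarrow> ?W (h k) = ?W' (h' (\<sigma> k)) \<and> h k = h' (\<sigma> k)" by blast
  have 1: "?W a = ?W' a" if "?W a > 0"
  proof -
    have "a \<in> h ` {1..K}" unfolding h(3) using that by simp
    then obtain k where k: "k \<in> {1..K}" "a = h k" by (rule imageE)
    show ?thesis using \<sigma>(2)[OF k(1)] unfolding k(2) by metis
  qed
  have 2: "?W a = ?W' a" if "?W' a > 0"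
  proof -
    have "a \<in> h' ` {1..K'}" unfolding h'(3) using that by simp
    then obtain i where i: "i \<in> {1..K'}" "a = h' i" by (rule imageE)
    then have "i \<in> \<sigma> ` {1..K}" using \<sigma>(1) by (simp add: bij_betw_def)
    then obtain k where k: "k \<in> {1..K}" "i = \<sigma> k" by (rule imageE)
    show ?thesis using \<sigma>(2)[OF k(1)] unfolding i(2) k(2) by metis
  qed
  have "?W a \<ge> 0" "?W' a \<ge> 0" using l by (simp_all add: atom_weight_nonneg)
  then show ?thesis using 1 2 by linarith
qed

lemma emeasure_weighted_sum_const:
  assumes fin: "finite I" and m: "\<And>i. i \<in> I \<Longrightarrow> sets (m i) = sets M" and B: "B \<in> sets M"
    and nn: "\<And>i. i \<in> I \<Longrightarrow> l i \<ge> 0" and e: "\<And>i. i \<in> I \<Longrightarrow> l i \<noteq> 0 \<Longrightarrow> emeasure (m i) B = e"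
  shows "emeasure (weighted_sum M I l m) B = ennreal (sum l I) * e"
proof -
  have "emeasure (weighted_sum M I l m) B = (\<Sum>i\<in>I. ennreal (l i) * emeasure (m i) B)"
    by (rule emeasure_weighted_sum[OF fin m B])
  also have "\<dots> = (\<Sum>i\<in>I. ennreal (l i) * e)"
  proof (rule sum.cong[OF refl])
    fix i assume "i \<in> I"
    then show "ennreal (l i) * emeasure (m i) B = ennreal (l i) * e"
      using e by (cases "l i = 0") auto
  qed
  also have "\<dots> = ennreal (sum l I) * e"
    using nn by (simp add: sum_distrib_right[symmetric] sum_ennreal)
  finally show ?thesis .
qed

lemma prob_space_weighted_sum:
  assumes "finite I" "\<And>i. i \<in> I \<Longrightarrow> m i \<in> prob_measures M" "\<And>i. i \<in> I \<Longrightarrow> l i \<ge> 0" "sum l I = 1"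
  shows "prob_space (weighted_sum M I l m)"
proof
  have "sets (m i) = sets M" "emeasure (m i) (space M) = 1" if "i \<in> I" for i
    using assms(2)[OF that] prob_space.emeasure_space_1[of "m i"] sets_eq_imp_space_eq[of "m i" M]
    by (auto simp: prob_measures_def)
  then show "emeasure (weighted_sum M I l m) (space (weighted_sum M I l m)) = 1"
    using assms emeasure_weighted_sum_const[of I m M "space M" l 1] by simp
qed

text \<open>Taking marginals commutes with forming mixtures.\<close>

lemma weighted_sum_couplings:
  assumes fin: "finite I" and \<nu>: "\<nu>0 \<in> prob_measures M" "\<nu>1 \<in> prob_measures M"
    and a: "\<And>i. i \<in> I \<Longrightarrow> a i \<in> prob_measures M" and b: "\<And>i. i \<in> I \<Longrightarrow> b i \<in> prob_measures M"
    and g: "\<And>i. i \<in> I \<Longrightarrow> g i \<in> couplings (a i) (b i)"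
    and nn: "\<And>i. i \<in> I \<Longrightarrow> l i \<ge> 0" and s: "sum l I = 1"
  shows "weighted_sum (M \<Otimes>\<^sub>M M) I l g \<in> couplings \<nu>0 \<nu>1 \<longleftrightarrow>
    weighted_sum M I l a = \<nu>0 \<and> weighted_sum M I l b = \<nu>1"
proof -
  let ?\<gamma> = "weighted_sum (M \<Otimes>\<^sub>M M) I l g"
  have sa: "sets (a i) = sets M" "space (a i) = space M" and sb: "sets (b i) = sets M" "space (b i) = space M" if "i \<in> I" for i
    using a[OF that] b[OF that] sets_eq_imp_space_eq by (auto simp: prob_measures_def)
  have s\<nu>: "sets \<nu>0 = sets M" "sets \<nu>1 = sets M" "space \<nu>0 = space M" "space \<nu>1 = space M"
    using \<nu> sets_eq_imp_space_eq by (auto simp: prob_measures_def)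
  have sg: "sets (g i) = sets (M \<Otimes>\<^sub>M M)" if "i \<in> I" for i
    using couplingsD(2)[OF g[OF that]] sets_pair_measure_cong[OF sa(1)[OF that] sb(1)[OF that]] by simp
  have p: "prob_space ?\<gamma>"
    using couplingsD(1)[OF g] sg by (intro prob_space_weighted_sum fin nn s) (auto simp: prob_measures_def)
  have st: "sets ?\<gamma> = sets (\<nu>0 \<Otimes>\<^sub>M \<nu>1)"
    using sets_pair_measure_cong[OF s\<nu>(1,2)] by simp
  have 0: "emeasure ?\<gamma> (B \<times> space M) = emeasure (weighted_sum M I l a) B" if B: "B \<in> sets M" for B
  proof -
    have "emeasure (g i) (B \<times> space M) = emeasure (a i) B" if "i \<in> I" for i
      using couplingsD(4)[OF g[OF that], of B] sa[OF that] sb[OF that] B by simp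
    then show ?thesis using B fin sg sa by (simp add: emeasure_weighted_sum)
  qed
  have 1: "emeasure ?\<gamma> (space M \<times> B) = emeasure (weighted_sum M I l b) B" if B: "B \<in> sets M" for B
  proof -
    have "emeasure (g i) (space M \<times> B) = emeasure (b i) B" if "i \<in> I" for i
      using couplingsD(5)[OF g[OF that], of B] sa[OF that] sb[OF that] B by simp
    then show ?thesis using B fin sg sb by (simp add: emeasure_weighted_sum)
  qed
  show ?thesis
  proof
    assume c: "?\<gamma> \<in> couplings \<nu>0 \<nu>1"
    show "weighted_sum M I l a = \<nu>0 \<and> weighted_sum M I l b = \<nu>1"
      using 0 1 couplingsD(4,5)[OF c] s\<nu> by (auto intro!: measure_eqI)
  next
    assume "weighted_sum M I l a = \<nu>0 \<and> weighted_sum M I l b = \<nu>1"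
    then show "?\<gamma> \<in> couplings \<nu>0 \<nu>1"
      using 0 1 s\<nu> by (intro couplingsI[OF p st]) auto
  qed
qed

lemma weighted_sum_reindex:
  assumes h: "bij_betw h I' I" and fin: "finite I" and m: "\<And>i. i \<in> I \<Longrightarrow> sets (m i) = sets M"
  shows "weighted_sum M I' (\<lambda>i. l (h i)) (\<lambda>i. m (h i)) = weighted_sum M I l m"
proof (rule measure_eqI)
  fix B assume "B \<in> sets (weighted_sum M I' (\<lambda>i. l (h i)) (\<lambda>i. m (h i)))"
  then have B: "B \<in> sets M" by simp
  have "finite I'" "\<And>i. i \<in> I' \<Longrightarrow> h i \<in> I" using h fin by (auto simp: bij_betw_finite bij_betw_def)
  then show "emeasure (weighted_sum M I' (\<lambda>i. l (h i)) (\<lambda>i. m (h i))) B = emeasure (weighted_sum M I l m) B"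
    using sum.reindex_bij_betw[OF h, of "\<lambda>i. ennreal (l i) * emeasure (m i) B"] m B fin
    by (simp add: emeasure_weighted_sum)
qed simp

lemma weighted_sum_fst:
  assumes w: "w \<in> weight_couplings J0 J1 l0 l1" and m: "\<And>j. j \<in> {1..J0} \<Longrightarrow> sets (m j) = sets M"
  shows "weighted_sum M ({1..J0} \<times> {1..J1}) (\<lambda>(j0, j1). w j0 j1) (\<lambda>(j0, j1). m j0) = mixture M J0 l0 m"
proof (rule measure_eqI)
  fix B assume "B \<in> sets (weighted_sum M ({1..J0} \<times> {1..J1}) (\<lambda>(j0, j1). w j0 j1) (\<lambda>(j0, j1). m j0))"
  then have B: "B \<in> sets M" by simp
  have "emeasure (weighted_sum M ({1..J0} \<times> {1..J1}) (\<lambda>(j0, j1). w j0 j1) (\<lambda>(j0, j1). m j0)) B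
      = (\<Sum>(j0, j1)\<in>{1..J0} \<times> {1..J1}. ennreal (w j0 j1) * emeasure (m j0) B)"
    using B m by (subst emeasure_weighted_sum) (auto simp: case_prod_beta)
  also have "\<dots> = (\<Sum>j0\<in>{1..J0}. (\<Sum>j1\<in>{1..J1}. ennreal (w j0 j1)) * emeasure (m j0) B)"
    by (simp add: sum.cartesian_product[symmetric] sum_distrib_right)
  also have "\<dots> = (\<Sum>j0\<in>{1..J0}. ennreal (l0 j0) * emeasure (m j0) B)"
  proof (rule sum.cong[OF refl])
    fix j0 assume j0: "j0 \<in> {1..J0}"
    have "(\<Sum>j1\<in>{1..J1}. ennreal (w j0 j1)) = ennreal (\<Sum>j1\<in>{1..J1}. w j0 j1)"
      using w j0 by (intro sum_ennreal) (simp add: weight_couplings_def)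
    also have "\<dots> = ennreal (l0 j0)" using w j0 by (simp add: weight_couplings_def)
    finally show "(\<Sum>j1\<in>{1..J1}. ennreal (w j0 j1)) * emeasure (m j0) B = ennreal (l0 j0) * emeasure (m j0) B"
      by simp
  qed
  also have "\<dots> = emeasure (mixture M J0 l0 m) B"
    using B m by (intro emeasure_weighted_sum[symmetric]) auto
  finally show "emeasure (weighted_sum M ({1..J0} \<times> {1..J1}) (\<lambda>(j0, j1). w j0 j1) (\<lambda>(j0, j1). m j0)) B
    = emeasure (mixture M J0 l0 m) B" .
qed simp

lemma weighted_sum_snd:
  assumes w: "w \<in> weight_couplings J0 J1 l0 l1" and m: "\<And>j. j \<in> {1..J1} \<Longrightarrow> sets (m j) = sets M"
  shows "weighted_sum M ({1..J0} \<times> {1..J1}) (\<lambda>(j0, j1). w j0 j1) (\<lambda>(j0, j1). m j1) = mixture M J1 l1 m"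
proof -
  have "(\<lambda>j1 j0. w j0 j1) \<in> weight_couplings J1 J0 l1 l0"
    using w by (auto simp: weight_couplings_def)
  from weighted_sum_fst[OF this m]
  have "weighted_sum M ({1..J1} \<times> {1..J0}) (\<lambda>(j1, j0). w j0 j1) (\<lambda>(j1, j0). m j1) = mixture M J1 l1 m"
    by simp
  moreover have "weighted_sum M ({1..J0} \<times> {1..J1}) (\<lambda>p. (\<lambda>(j1, j0). w j0 j1) (prod.swap p)) (\<lambda>p. (\<lambda>(j1, j0). m j1) (prod.swap p))
      = weighted_sum M ({1..J1} \<times> {1..J0}) (\<lambda>(j1, j0). w j0 j1) (\<lambda>(j1, j0). m j1)"
    using m by (intro weighted_sum_reindex) (auto simp: bij_betw_def inj_on_def)
  ultimately show ?thesis by (simp add: case_prod_beta')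
qed

section \<open>Plans that are mixtures of couplings of atoms\<close>

lemma weighted_sum_in_mix_couplings:
  fixes \<Omega> :: "'a::polish_space set"
  assumes A: "A \<subseteq> prob_measures (borel_on \<Omega>)" and J: "J0 \<ge> 1" "J1 \<ge> 1"
    and l: "l0 \<in> simplex_weights J0" "l1 \<in> simplex_weights J1"
    and m0: "\<And>j. j \<in> {1..J0} \<Longrightarrow> m0 j \<in> A" and m1: "\<And>j. j \<in> {1..J1} \<Longrightarrow> m1 j \<in> A"
    and w: "w \<in> weight_couplings J0 J1 l0 l1"
    and g: "\<And>j0 j1. j0 \<in> {1..J0} \<Longrightarrow> j1 \<in> {1..J1} \<Longrightarrow> g j0 j1 \<in> couplings (m0 j0) (m1 j1)"
  shows "weighted_sum (borel_on \<Omega> \<Otimes>\<^sub>M borel_on \<Omega>) ({1..J0} \<times> {1..J1}) (\<lambda>(j0, j1). w j0 j1) (\<lambda>(j0, j1). g j0 j1)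
    \<in> mix_couplings \<Omega> A (mixture (borel_on \<Omega>) J0 l0 m0) (mixture (borel_on \<Omega>) J1 l1 m1)"
proof -
  let ?M = "borel_on \<Omega>" and ?I = "{1..J0} \<times> {1..J1}" and ?w = "\<lambda>(j0, j1). w j0 j1" and ?g = "\<lambda>(j0, j1). g j0 j1"
  have pm: "m0 j \<in> prob_measures ?M" if "j \<in> {1..J0}" for j using m0[OF that] A by blast
  have pm': "m1 j \<in> prob_measures ?M" if "j \<in> {1..J1}" for j using m1[OF that] A by blast
  have wnn: "?w i \<ge> 0" if "i \<in> ?I" for i using w that by (auto simp: weight_couplings_def)
  have wsum: "sum ?w ?I = 1"
  proof -
    have "sum ?w ?I = (\<Sum>j0\<in>{1..J0}. \<Sum>j1\<in>{1..J1}. w j0 j1)" by (simp add: sum.cartesian_product)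
    also have "\<dots> = (\<Sum>j0\<in>{1..J0}. l0 j0)" using w by (intro sum.cong) (auto simp: weight_couplings_def)
    finally show ?thesis using simplex_weightsD(2)[OF l(1)] by simp
  qed
  have \<nu>: "mixture ?M J0 l0 m0 \<in> prob_measures ?M" "mixture ?M J1 l1 m1 \<in> prob_measures ?M"
    using pm pm' simplex_weightsD[OF l(1)] simplex_weightsD[OF l(2)]
    by (auto simp: prob_measures_def[of ?M] intro!: prob_space_weighted_sum)
  have c: "weighted_sum (?M \<Otimes>\<^sub>M ?M) ?I ?w ?g \<in> couplings (mixture ?M J0 l0 m0) (mixture ?M J1 l1 m1)"
  proof (subst weighted_sum_couplings[where a = "\<lambda>(j0, j1). m0 j0" and b = "\<lambda>(j0, j1). m1 j1"])
    show "weighted_sum ?M ?I ?w (\<lambda>(j0, j1). m0 j0) = mixture ?M J0 l0 m0 \<and>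
        weighted_sum ?M ?I ?w (\<lambda>(j0, j1). m1 j1) = mixture ?M J1 l1 m1"
      using pm pm' by (intro conjI weighted_sum_fst[OF w] weighted_sum_snd[OF w]) (auto simp: prob_measures_def)
  qed (use \<nu> pm pm' g wnn wsum in auto)
  \<comment> \<open>Mixtures are indexed by initial segments, so the pairs of indices are enumerated.\<close>
  have fin: "finite ?I" by simp
  obtain h where h: "bij_betw h {1..card ?I} ?I" using ex_bij_betw_nat_finite_1[OF fin] by blast
  have hI: "h k \<in> ?I" if "k \<in> {1..card ?I}" for k using bij_betwE[OF h] that by blast
  have gd: "?g i \<in> dict_couplings A" if "i \<in> ?I" for i
    using that g m0 m1 by (fastforce simp: dict_couplings_def)
  have sg: "sets (?g i) = sets (?M \<Otimes>\<^sub>M ?M)" if i: "i \<in> ?I" for i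
  proof -
    obtain j0 j1 where j: "i = (j0, j1)" "j0 \<in> {1..J0}" "j1 \<in> {1..J1}" using i by auto
    have "sets (m0 j0 \<Otimes>\<^sub>M m1 j1) = sets (?M \<Otimes>\<^sub>M ?M)"
      using pm[OF j(2)] pm'[OF j(3)] by (intro sets_pair_measure_cong) (auto simp: prob_measures_def)
    then show ?thesis using couplingsD(2)[OF g[OF j(2,3)]] j(1) by simp
  qed
  have "weighted_sum (?M \<Otimes>\<^sub>M ?M) ?I ?w ?g = mixture (?M \<Otimes>\<^sub>M ?M) (card ?I) (\<lambda>k. ?w (h k)) (\<lambda>k. ?g (h k))"
    by (rule weighted_sum_reindex[OF h fin sg, symmetric])
  moreover have "card ?I \<ge> 1" using J by simp
  moreover have "(\<lambda>k. ?w (h k)) \<in> simplex_weights (card ?I)"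
    using wnn hI wsum sum.reindex_bij_betw[OF h, of ?w] by (intro simplex_weightsI) auto
  moreover have "\<forall>k\<in>{1..card ?I}. ?g (h k) \<in> dict_couplings A" using gd hI by blast
  ultimately have "weighted_sum (?M \<Otimes>\<^sub>M ?M) ?I ?w ?g \<in> mixtures (?M \<Otimes>\<^sub>M ?M) (dict_couplings A)"
    unfolding mixtures_def by blast
  with c show ?thesis by (simp add: mix_couplings_def)
qed

text \<open>\<open>u k j\<close> is the share of the \<open>k\<close>-th mass of the first mixture that goes to the \<open>j\<close>-th mass of the
  second.  Each atom's mass is distributed in proportion to the weights \<open>l\<close>; equality of the
  total weights makes the received masses come out as \<open>l\<close>.\<close>

lemma transfer_atom_weights:
  assumes p: "p \<in> simplex_weights K" and l: "l \<in> simplex_weights J"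
    and eq: "\<And>x. atom_weight K p a x = atom_weight J l m x"
  obtains u :: "nat \<Rightarrow> nat \<Rightarrow> real" where "\<And>k j. j \<in> {1..J} \<Longrightarrow> u k j \<ge> 0" "\<And>k j. u k j \<noteq> 0 \<Longrightarrow> m j = a k"
    "\<And>k. k \<in> {1..K} \<Longrightarrow> p k \<noteq> 0 \<Longrightarrow> (\<Sum>j\<in>{1..J}. u k j) = 1"
    "\<And>j. j \<in> {1..J} \<Longrightarrow> (\<Sum>k\<in>{1..K}. p k * u k j) = l j"
proof -
  let ?W = "atom_weight J l m"
  define u where "u k j = (if m j = a k then l j / ?W (a k) else 0)" for k j
  have "u k j \<ge> 0" if "j \<in> {1..J}" for k j
    using simplex_weightsD(1)[OF l that] atom_weight_nonneg[OF l, of m] by (simp add: u_def)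
  moreover have "m j = a k" if "u k j \<noteq> 0" for k j
    using that by (auto simp: u_def split: if_splits)
  moreover have "(\<Sum>j\<in>{1..J}. u k j) = 1" if k: "k \<in> {1..K}" "p k \<noteq> 0" for k
  proof -
    \<comment> \<open>The quotient in \<open>u\<close> is legitimate where it matters: an atom that carries mass has positive weight.\<close>
    have "?W (a k) > 0"
      using atom_weight_ge[OF p k(1), of a] simplex_weightsD(1)[OF p k(1)] k(2) by (simp add: eq)
    moreover have "(\<Sum>j\<in>{1..J}. u k j) = (\<Sum>j\<in>{j\<in>{1..J}. m j = a k}. l j / ?W (a k))"
      unfolding u_def by (rule sum.inter_filter[symmetric]) simp
    moreover have "\<dots> = ?W (a k) / ?W (a k)"
      unfolding sum_divide_distrib[symmetric] by (simp add: atom_weight_def)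
    ultimately show ?thesis by simp
  qed
  moreover have "(\<Sum>k\<in>{1..K}. p k * u k j) = l j" if j: "j \<in> {1..J}" for j
  proof -
    have "(\<Sum>k\<in>{1..K}. p k * u k j) = (\<Sum>k\<in>{1..K}. if a k = m j then p k * (l j / ?W (m j)) else 0)"
      by (intro sum.cong) (auto simp: u_def)
    also have "\<dots> = (\<Sum>k\<in>{k\<in>{1..K}. a k = m j}. p k * (l j / ?W (m j)))"
      by (rule sum.inter_filter[symmetric]) simp
    also have "\<dots> = atom_weight K p a (m j) * (l j / ?W (m j))"
      unfolding atom_weight_def[of K] by (rule sum_distrib_right[symmetric])
    also have "\<dots> = l j"
      using atom_weight_ge[OF l j, of m] simplex_weightsD(1)[OF l j] by (auto simp: eq)
    finally show ?thesis .
  qed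
  ultimately show thesis by (rule that)
qed

text \<open>The converse of \<open>weighted_sum_in_mix_couplings\<close>.  Identifiability of the two marginals makes it
  possible to redistribute the masses of an arbitrary mixture of couplings over the given pairs of
  indices, independently on the two sides.\<close>

lemma mix_couplings_decompose:
  fixes \<Omega> :: "'a::polish_space set"
  assumes A: "A \<subseteq> prob_measures (borel_on \<Omega>)" and id: "identifiable (borel_on \<Omega>) A"
    and J: "J0 \<ge> 1" "J1 \<ge> 1"
    and l: "l0 \<in> simplex_weights J0" "l1 \<in> simplex_weights J1"
    and m0: "\<And>j. j \<in> {1..J0} \<Longrightarrow> m0 j \<in> A" and m1: "\<And>j. j \<in> {1..J1} \<Longrightarrow> m1 j \<in> A"
    and \<gamma>: "\<gamma> \<in> mix_couplings \<Omega> A (mixture (borel_on \<Omega>) J0 l0 m0) (mixture (borel_on \<Omega>) J1 l1 m1)"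
  obtains w g where "w \<in> weight_couplings J0 J1 l0 l1"
    "\<And>j0 j1. j0 \<in> {1..J0} \<Longrightarrow> j1 \<in> {1..J1} \<Longrightarrow> g j0 j1 \<in> couplings (m0 j0) (m1 j1)"
    "\<gamma> = weighted_sum (borel_on \<Omega> \<Otimes>\<^sub>M borel_on \<Omega>) ({1..J0} \<times> {1..J1}) (\<lambda>(j0, j1). w j0 j1) (\<lambda>(j0, j1). g j0 j1)"
proof -
  let ?M = "borel_on \<Omega>"
  let ?\<nu>0 = "mixture ?M J0 l0 m0" and ?\<nu>1 = "mixture ?M J1 l1 m1"
  obtain K p q where K: "K \<ge> 1" and p: "p \<in> simplex_weights K"
    and q: "\<And>k. k \<in> {1..K} \<Longrightarrow> q k \<in> dict_couplings A"
    and \<gamma>q: "\<gamma> = mixture (?M \<Otimes>\<^sub>M ?M) K p q" and \<gamma>c: "\<gamma> \<in> couplings ?\<nu>0 ?\<nu>1"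
    using \<gamma> unfolding mix_couplings_def mixtures_def by blast
  have "\<forall>k\<in>{1..K}. \<exists>a b. a \<in> A \<and> b \<in> A \<and> q k \<in> couplings a b"
    using q unfolding dict_couplings_def by blast
  then obtain a b where a: "\<And>k. k \<in> {1..K} \<Longrightarrow> a k \<in> A" and b: "\<And>k. k \<in> {1..K} \<Longrightarrow> b k \<in> A"
    and qc: "\<And>k. k \<in> {1..K} \<Longrightarrow> q k \<in> couplings (a k) (b k)"
    by metis
  have Apm: "x \<in> prob_measures ?M" if "x \<in> A" for x using A that by blast
  have As: "sets x = sets ?M" "space x = \<Omega>" "prob_space x" if "x \<in> A" for x
    using Apm[OF that] sets_eq_imp_space_eq[of x ?M] by (auto simp: prob_measures_def space_restrict_space)
  have pnn: "p k \<ge> 0" if "k \<in> {1..K}" for k using simplex_weightsD(1)[OF p that] .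
  have \<nu>: "?\<nu>0 \<in> prob_measures ?M" "?\<nu>1 \<in> prob_measures ?M"
    using m0 m1 Apm simplex_weightsD[OF l(1)] simplex_weightsD[OF l(2)]
    by (auto simp: prob_measures_def[of ?M] intro!: prob_space_weighted_sum)
  have "mixture ?M K p a = ?\<nu>0 \<and> mixture ?M K p b = ?\<nu>1"
    using \<gamma>c unfolding \<gamma>q
    by (subst (asm) weighted_sum_couplings[OF _ \<nu> _ _ qc]) (use a b Apm pnn simplex_weightsD(2)[OF p] in auto)
  then have mix: "mixture ?M K p a = ?\<nu>0" "mixture ?M K p b = ?\<nu>1" by auto
  obtain u where unn: "\<And>k j. j \<in> {1..J0} \<Longrightarrow> u k j \<ge> 0" and ua: "\<And>k j. u k j \<noteq> 0 \<Longrightarrow> m0 j = a k"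
    and usum: "\<And>k. k \<in> {1..K} \<Longrightarrow> p k \<noteq> 0 \<Longrightarrow> (\<Sum>j\<in>{1..J0}. u k j) = 1"
    and pu: "\<And>j. j \<in> {1..J0} \<Longrightarrow> (\<Sum>k\<in>{1..K}. p k * u k j) = l0 j"
    by (rule transfer_atom_weights[OF p l(1)
          identifiable_atom_weight_eq[OF id A K J(1) p l(1) _ _ mix(1)]]) (use a m0 in auto)
  obtain v where vnn: "\<And>k j. j \<in> {1..J1} \<Longrightarrow> v k j \<ge> 0" and vb: "\<And>k j. v k j \<noteq> 0 \<Longrightarrow> m1 j = b k"
    and vsum: "\<And>k. k \<in> {1..K} \<Longrightarrow> p k \<noteq> 0 \<Longrightarrow> (\<Sum>j\<in>{1..J1}. v k j) = 1"
    and pv: "\<And>j. j \<in> {1..J1} \<Longrightarrow> (\<Sum>k\<in>{1..K}. p k * v k j) = l1 j"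
    by (rule transfer_atom_weights[OF p l(2)
          identifiable_atom_weight_eq[OF id A K J(2) p l(2) _ _ mix(2)]]) (use b m1 in auto)
  \<comment> \<open>The mass that \<open>q k\<close> contributes to the pair \<open>(j0, j1)\<close>; it vanishes unless \<open>q k\<close> couples \<open>m0 j0\<close> and \<open>m1 j1\<close>.\<close>
  define \<theta> where "\<theta> j0 j1 k = p k * u k j0 * v k j1" for j0 j1 k
  have \<theta>nn: "\<theta> j0 j1 k \<ge> 0" if "j0 \<in> {1..J0}" "j1 \<in> {1..J1}" "k \<in> {1..K}" for j0 j1 k
    using that pnn unn vnn by (simp add: \<theta>_def)
  have \<theta>ab: "m0 j0 = a k \<and> m1 j1 = b k" if "\<theta> j0 j1 k \<noteq> 0" for j0 j1 k
    using that ua[of k j0] vb[of k j1] by (auto simp: \<theta>_def)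
  define w where "w j0 j1 = (\<Sum>k\<in>{1..K}. \<theta> j0 j1 k)" for j0 j1
  have "(\<Sum>j1\<in>{1..J1}. w j0 j1) = l0 j0" if j0: "j0 \<in> {1..J0}" for j0
  proof -
    have "(\<Sum>j1\<in>{1..J1}. w j0 j1) = (\<Sum>k\<in>{1..K}. \<Sum>j1\<in>{1..J1}. \<theta> j0 j1 k)"
      unfolding w_def by (rule sum.swap)
    also have "\<dots> = (\<Sum>k\<in>{1..K}. p k * u k j0)"
    proof (rule sum.cong[OF refl])
      fix k assume k: "k \<in> {1..K}"
      have "(\<Sum>j1\<in>{1..J1}. \<theta> j0 j1 k) = p k * u k j0 * (\<Sum>j1\<in>{1..J1}. v k j1)"
        by (simp add: \<theta>_def sum_distrib_left)
      then show "(\<Sum>j1\<in>{1..J1}. \<theta> j0 j1 k) = p k * u k j0"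
        using vsum[OF k] by (cases "p k = 0") auto
    qed
    finally show ?thesis using pu[OF j0] by simp
  qed
  moreover have "(\<Sum>j0\<in>{1..J0}. w j0 j1) = l1 j1" if j1: "j1 \<in> {1..J1}" for j1
  proof -
    have "(\<Sum>j0\<in>{1..J0}. w j0 j1) = (\<Sum>k\<in>{1..K}. \<Sum>j0\<in>{1..J0}. \<theta> j0 j1 k)"
      unfolding w_def by (rule sum.swap)
    also have "\<dots> = (\<Sum>k\<in>{1..K}. p k * v k j1)"
    proof (rule sum.cong[OF refl])
      fix k assume k: "k \<in> {1..K}"
      have "(\<Sum>j0\<in>{1..J0}. \<theta> j0 j1 k) = p k * v k j1 * (\<Sum>j0\<in>{1..J0}. u k j0)"
        by (simp add: \<theta>_def sum_distrib_left mult.commute mult.left_commute)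
      then show "(\<Sum>j0\<in>{1..J0}. \<theta> j0 j1 k) = p k * v k j1"
        using usum[OF k] by (cases "p k = 0") auto
    qed
    finally show ?thesis using pv[OF j1] by simp
  qed
  moreover have wnn: "w j0 j1 \<ge> 0" if "j0 \<in> {1..J0}" "j1 \<in> {1..J1}" for j0 j1
    unfolding w_def using \<theta>nn[OF that] by (rule sum_nonneg)
  ultimately have w: "w \<in> weight_couplings J0 J1 l0 l1" by (auto simp: weight_couplings_def)
  \<comment> \<open>Normalized contributions; where nothing is contributed any coupling will do, here the product.\<close>
  define g where "g j0 j1 = (if w j0 j1 = 0 then m0 j0 \<Otimes>\<^sub>M m1 j1
    else weighted_sum (?M \<Otimes>\<^sub>M ?M) {1..K} (\<lambda>k. \<theta> j0 j1 k / w j0 j1) q)" for j0 j1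
  have qs: "sets (q k) = sets (?M \<Otimes>\<^sub>M ?M)" if "k \<in> {1..K}" for k
    using couplingsD(2)[OF qc[OF that]] sets_pair_measure_cong[OF As(1)[OF a[OF that]] As(1)[OF b[OF that]]] by simp
  have \<theta>sum: "(\<Sum>k\<in>{1..K}. \<theta> j0 j1 k / w j0 j1) = 1" if "w j0 j1 \<noteq> 0" for j0 j1
    using that unfolding sum_divide_distrib[symmetric] by (simp add: w_def)
  have g: "g j0 j1 \<in> couplings (m0 j0) (m1 j1)" if j: "j0 \<in> {1..J0}" "j1 \<in> {1..J1}" for j0 j1
  proof (cases "w j0 j1 = 0")
    case True
    then show ?thesis using pair_measure_in_couplings[OF As(3)[OF m0] As(3)[OF m1]] j by (simp add: g_def)
  next
    case False
    let ?t = "\<lambda>k. \<theta> j0 j1 k / w j0 j1"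
    have tnn: "?t k \<ge> 0" if "k \<in> {1..K}" for k using \<theta>nn[OF j that] wnn[OF j] by simp
    have eqI: "weighted_sum ?M {1..K} ?t x = y"
      if "\<And>k. k \<in> {1..K} \<Longrightarrow> x k \<in> A" "y \<in> A" "\<And>k. ?t k \<noteq> 0 \<Longrightarrow> x k = y" for x y
    proof (rule measure_eqI)
      fix B assume "B \<in> sets (weighted_sum ?M {1..K} ?t x)"
      then have B: "B \<in> sets ?M" by simp
      have "emeasure (weighted_sum ?M {1..K} ?t x) B = ennreal (sum ?t {1..K}) * emeasure y B"
        by (rule emeasure_weighted_sum_const[OF _ _ B tnn]) (use that As in auto)
      then show "emeasure (weighted_sum ?M {1..K} ?t x) B = emeasure y B" using \<theta>sum[OF False] by simp
    qed (use As that(2) in simp)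
    have "weighted_sum (?M \<Otimes>\<^sub>M ?M) {1..K} ?t q \<in> couplings (m0 j0) (m1 j1)"
    proof (subst weighted_sum_couplings[OF _ _ _ _ _ qc])
      show "weighted_sum ?M {1..K} ?t a = m0 j0 \<and> weighted_sum ?M {1..K} ?t b = m1 j1"
      proof (intro conjI eqI)
        show "a k = m0 j0" if "?t k \<noteq> 0" for k using that \<theta>ab[of j0 j1 k] by simp
        show "b k = m1 j1" if "?t k \<noteq> 0" for k using that \<theta>ab[of j0 j1 k] by simp
      qed (use a b m0[OF j(1)] m1[OF j(2)] in auto)
    qed (use Apm a b m0 m1 j tnn \<theta>sum[OF False] in auto)
    then show ?thesis using False by (simp add: g_def)
  qed
  have gs: "sets (g j0 j1) = sets (?M \<Otimes>\<^sub>M ?M)" if "j0 \<in> {1..J0}" "j1 \<in> {1..J1}" for j0 j1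
    using couplingsD(2)[OF g[OF that]] sets_pair_measure_cong[OF As(1)[OF m0[OF that(1)]] As(1)[OF m1[OF that(2)]]] by simp
  let ?I = "{1..J0} \<times> {1..J1}"
  have "\<gamma> = weighted_sum (?M \<Otimes>\<^sub>M ?M) ?I (\<lambda>(j0, j1). w j0 j1) (\<lambda>(j0, j1). g j0 j1)"
  proof (rule measure_eqI)
    fix E assume "E \<in> sets \<gamma>"
    then have E: "E \<in> sets (?M \<Otimes>\<^sub>M ?M)" by (simp add: \<gamma>q)
    have em_mix: "emeasure (mixture (?M \<Otimes>\<^sub>M ?M) K r q) E = (\<Sum>k\<in>{1..K}. ennreal (r k) * emeasure (q k) E)" for r
      using E qs by (intro emeasure_weighted_sum) auto
    have wg: "ennreal (w j0 j1) * emeasure (g j0 j1) E = (\<Sum>k\<in>{1..K}. ennreal (\<theta> j0 j1 k) * emeasure (q k) E)"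
      if j: "j0 \<in> {1..J0}" "j1 \<in> {1..J1}" for j0 j1
    proof (cases "w j0 j1 = 0")
      case True
      then have "\<theta> j0 j1 k = 0" if "k \<in> {1..K}" for k
        using that \<theta>nn[OF j] unfolding w_def by (subst (asm) sum_nonneg_eq_0_iff) auto
      then show ?thesis using True by simp
    next
      case False
      then have pos: "w j0 j1 > 0" using wnn[OF j] by simp
      have "ennreal (w j0 j1) * emeasure (g j0 j1) E
          = (\<Sum>k\<in>{1..K}. ennreal (w j0 j1) * (ennreal (\<theta> j0 j1 k / w j0 j1) * emeasure (q k) E))"
        using False by (simp only: g_def if_False em_mix sum_distrib_left)
      also have "\<dots> = (\<Sum>k\<in>{1..K}. ennreal (\<theta> j0 j1 k) * emeasure (q k) E)"
      proof (rule sum.cong[OF refl])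
        fix k assume "k \<in> {1..K}"
        then have "ennreal (w j0 j1) * ennreal (\<theta> j0 j1 k / w j0 j1) = ennreal (\<theta> j0 j1 k)"
          using pos \<theta>nn[OF j] by (subst ennreal_mult[symmetric]) auto
        then show "ennreal (w j0 j1) * (ennreal (\<theta> j0 j1 k / w j0 j1) * emeasure (q k) E) = ennreal (\<theta> j0 j1 k) * emeasure (q k) E"
          by (metis mult.assoc)
      qed
      finally show ?thesis .
    qed
    have "(\<Sum>j0\<in>{1..J0}. \<Sum>j1\<in>{1..J1}. \<theta> j0 j1 k) = p k" if k: "k \<in> {1..K}" for k
    proof -
      have "(\<Sum>j0\<in>{1..J0}. \<Sum>j1\<in>{1..J1}. \<theta> j0 j1 k) = p k * ((\<Sum>j0\<in>{1..J0}. u k j0) * (\<Sum>j1\<in>{1..J1}. v k j1))"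
        unfolding sum_product by (simp add: \<theta>_def sum_distrib_left mult.assoc)
      then show ?thesis using usum[OF k] vsum[OF k] by (cases "p k = 0") auto
    qed
    note \<theta>_total = this
    have \<theta>p: "(\<Sum>(j0, j1)\<in>?I. ennreal (\<theta> j0 j1 k)) = ennreal (p k)" if k: "k \<in> {1..K}" for k
    proof -
      have "(\<Sum>(j0, j1)\<in>?I. ennreal (\<theta> j0 j1 k)) = (\<Sum>i\<in>?I. ennreal (\<theta> (fst i) (snd i) k))"
        by (simp add: case_prod_beta)
      also have "\<dots> = ennreal (\<Sum>i\<in>?I. \<theta> (fst i) (snd i) k)"
        using \<theta>nn[OF _ _ k] by (intro sum_ennreal) auto
      also have "(\<Sum>i\<in>?I. \<theta> (fst i) (snd i) k) = p k"
        using \<theta>_total[OF k] by (simp add: sum.cartesian_product case_prod_beta)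
      finally show ?thesis .
    qed
    have "emeasure (weighted_sum (?M \<Otimes>\<^sub>M ?M) ?I (\<lambda>(j0, j1). w j0 j1) (\<lambda>(j0, j1). g j0 j1)) E
        = (\<Sum>(j0, j1)\<in>?I. ennreal (w j0 j1) * emeasure (g j0 j1) E)"
      using E gs by (subst emeasure_weighted_sum) (auto simp: case_prod_beta)
    also have "\<dots> = (\<Sum>(j0, j1)\<in>?I. \<Sum>k\<in>{1..K}. ennreal (\<theta> j0 j1 k) * emeasure (q k) E)"
      using wg by (intro sum.cong) auto
    also have "\<dots> = (\<Sum>k\<in>{1..K}. \<Sum>(j0, j1)\<in>?I. ennreal (\<theta> j0 j1 k) * emeasure (q k) E)"
      unfolding case_prod_beta by (rule sum.swap)
    also have "\<dots> = (\<Sum>k\<in>{1..K}. (\<Sum>(j0, j1)\<in>?I. ennreal (\<theta> j0 j1 k)) * emeasure (q k) E)"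
      by (simp add: sum_distrib_right case_prod_beta)
    also have "\<dots> = (\<Sum>k\<in>{1..K}. ennreal (p k) * emeasure (q k) E)"
      using \<theta>p by simp
    also have "\<dots> = emeasure \<gamma> E"
      unfolding \<gamma>q by (rule em_mix[symmetric])
    finally show "emeasure \<gamma> E = emeasure (weighted_sum (?M \<Otimes>\<^sub>M ?M) ?I (\<lambda>(j0, j1). w j0 j1) (\<lambda>(j0, j1). g j0 j1)) E" ..
  qed (simp add: \<gamma>q)
  with w g show thesis by (rule that)
qed

lemma cost_weighted_sum:
  fixes \<Omega> :: "'a::polish_space set" and J0 J1 :: nat
  assumes \<phi>: "\<phi> \<in> MI"
    and g: "\<And>j0 j1. j0 \<in> {1..J0} \<Longrightarrow> j1 \<in> {1..J1} \<Longrightarrow> sets (g j0 j1) = sets (borel_on \<Omega> \<Otimes>\<^sub>M borel_on \<Omega>)"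
  shows "cost \<phi> (weighted_sum (borel_on \<Omega> \<Otimes>\<^sub>M borel_on \<Omega>) ({1..J0} \<times> {1..J1})
      (\<lambda>(j0, j1). w j0 j1) (\<lambda>(j0, j1). g j0 j1))
    = (\<Sum>j0\<in>{1..J0}. \<Sum>j1\<in>{1..J1}. ennreal (w j0 j1) * cost \<phi> (g j0 j1))"
  unfolding cost_def
  by (subst nn_integral_weighted_sum[OF _ _ borel_measurable_cost[OF \<phi>]])
    (use g in \<open>auto simp: sum.cartesian_product case_prod_beta'\<close>)

section \<open>Equality of the two costs and their minimizers\<close>

theorem theorem4p1:
  fixes \<Omega> :: "'a::polish_space set"
    and \<phi> :: "real \<Rightarrow> real"
    and A :: "'a measure set"
    and J0 J1 :: nat
    and l0 l1 :: "nat \<Rightarrow> real"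
    and m0 m1 :: "nat \<Rightarrow> 'a measure"
    and \<nu>0 \<nu>1 :: "'a measure"
  assumes "\<Omega> \<in> sets borel"
    and "\<phi> \<in> MI"
    and "A \<noteq> {}"
    and "A \<subseteq> P_phi \<phi> \<Omega>"
    and "identifiable (borel_on \<Omega>) A"
    and "J0 \<ge> 1" and "J1 \<ge> 1"
    and "l0 \<in> simplex_weights J0" and "l1 \<in> simplex_weights J1"
    and "\<forall>j\<in>{1..J0}. m0 j \<in> A" and "\<forall>j\<in>{1..J1}. m1 j \<in> A"
    and "\<nu>0 = mixture (borel_on \<Omega>) J0 l0 m0"
    and "\<nu>1 = mixture (borel_on \<Omega>) J1 l1 m1"
  shows "MW \<phi> \<Omega> A \<nu>0 \<nu>1 = W_dict \<phi> J0 J1 l0 l1 m0 m1 \<and>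
    minimizers (cost \<phi>) (mix_couplings \<Omega> A \<nu>0 \<nu>1) =
      {weighted_sum (borel_on \<Omega> \<Otimes>\<^sub>M borel_on \<Omega>) ({1..J0} \<times> {1..J1})
         (\<lambda>(j0, j1). w j0 j1) (\<lambda>(j0, j1). g j0 j1) | w g.
       w \<in> minimizers (discrete_cost \<phi> J0 J1 m0 m1) (weight_couplings J0 J1 l0 l1) \<and>
       (\<forall>j0\<in>{1..J0}. \<forall>j1\<in>{1..J1}. g j0 j1 \<in> opt_couplings \<phi> (m0 j0) (m1 j1))}"
proof -
  note \<Omega> = assms(1) and \<phi> = assms(2) and id = assms(5) and J = assms(6,7) and l = assms(8,9)
  note \<nu> = assms(12,13)
  have m0: "m0 j \<in> A" if "j \<in> {1..J0}" for j using assms(10) that by blast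
  have m1: "m1 j \<in> A" if "j \<in> {1..J1}" for j using assms(11) that by blast
  have A: "A \<subseteq> prob_measures (borel_on \<Omega>)" using assms(4) by (auto simp: P_phi_def)
  let ?N = "borel_on \<Omega> \<Otimes>\<^sub>M borel_on \<Omega>" and ?I = "{1..J0} \<times> {1..J1}"
  let ?S = "\<lambda>w g. weighted_sum ?N ?I (\<lambda>(j0, j1). w j0 j1) (\<lambda>(j0, j1). g j0 j1)"
  let ?X = "mix_couplings \<Omega> A \<nu>0 \<nu>1" and ?Wc = "weight_couplings J0 J1 l0 l1"
  let ?D = "discrete_cost \<phi> J0 J1 m0 m1"
  let ?G = "\<lambda>g. \<forall>j0\<in>{1..J0}. \<forall>j1\<in>{1..J1}. g j0 j1 \<in> couplings (m0 j0) (m1 j1)"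
  define c where "c j0 j1 = extend_top \<phi> (W_phi \<phi> (m0 j0) (m1 j1))" for j0 j1
  have c_inf: "c j0 j1 = (INF \<gamma>\<in>couplings (m0 j0) (m1 j1). cost \<phi> \<gamma>)" for j0 j1
    by (simp add: c_def W_phi_def extend_top_ext_inv[OF \<phi>])
  have D: "?D w = (\<Sum>j0\<in>{1..J0}. \<Sum>j1\<in>{1..J1}. ennreal (w j0 j1) * c j0 j1)" for w
    by (simp add: discrete_cost_def c_def)
  have sets_coupling: "sets \<gamma> = sets ?N" if "\<gamma> \<in> couplings (m0 j0) (m1 j1)" "j0 \<in> {1..J0}" "j1 \<in> {1..J1}" for \<gamma> j0 j1
  proof -
    have "sets (m0 j0 \<Otimes>\<^sub>M m1 j1) = sets ?N"
      using m0[OF that(2)] m1[OF that(3)] A by (intro sets_pair_measure_cong) (auto simp: prob_measures_def)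
    then show ?thesis using couplingsD(2)[OF that(1)] by simp
  qed
  have costS: "cost \<phi> (?S w g) = (\<Sum>j0\<in>{1..J0}. \<Sum>j1\<in>{1..J1}. ennreal (w j0 j1) * cost \<phi> (g j0 j1))" if "?G g" for w g
    using that sets_coupling by (intro cost_weighted_sum[OF \<phi>]) blast
  have SX: "?S w g \<in> ?X" if "w \<in> ?Wc" "?G g" for w g
    unfolding \<nu> by (rule weighted_sum_in_mix_couplings[OF A J l m0 m1 that(1)]) (use that(2) in auto)
  have XS: "\<exists>w g. w \<in> ?Wc \<and> ?G g \<and> \<gamma> = ?S w g" if "\<gamma> \<in> ?X" for \<gamma>
    by (rule mix_couplings_decompose[OF A id J l m0 m1 that[unfolded \<nu>]]) blast+
  have "\<exists>\<gamma>. \<gamma> \<in> couplings (m0 j0) (m1 j1) \<and> cost \<phi> \<gamma> = c j0 j1" if j: "j0 \<in> {1..J0}" "j1 \<in> {1..J1}" for j0 j1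
  proof -
    have pm: "m0 j0 \<in> prob_measures (borel_on \<Omega>)" "m1 j1 \<in> prob_measures (borel_on \<Omega>)"
      using m0[OF j(1)] m1[OF j(2)] A by auto
    have "open {p::'a \<times> 'a. t < (case p of (x, y) \<Rightarrow> ennreal (\<phi> (dist x y)))}" for t
      using open_MI_greater[OF \<phi>, of "\<lambda>p::'a \<times> 'a. dist (fst p) (snd p)" t]
      by (simp add: case_prod_beta continuous_on_dist continuous_on_fst continuous_on_snd continuous_on_id)
    then obtain \<gamma> where \<gamma>: "\<gamma> \<in> couplings (m0 j0) (m1 j1)"
      "\<And>\<gamma>'. \<gamma>' \<in> couplings (m0 j0) (m1 j1) \<Longrightarrow> cost \<phi> \<gamma> \<le> cost \<phi> \<gamma>'"
      unfolding cost_def using exists_optimal_coupling[OF \<Omega> \<Omega> pm] by blast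
    then have "cost \<phi> \<gamma> = c j0 j1"
      unfolding c_inf by (intro antisym INF_greatest INF_lower) auto
    with \<gamma>(1) show ?thesis by blast
  qed
  \<comment> \<open>Fixed optimal couplings, which turn every \<open>w\<close> into an admissible plan whose cost is the discrete cost of \<open>w\<close>.\<close>
  then obtain g' where g': "\<And>j0 j1. j0 \<in> {1..J0} \<Longrightarrow> j1 \<in> {1..J1} \<Longrightarrow>
      g' j0 j1 \<in> couplings (m0 j0) (m1 j1) \<and> cost \<phi> (g' j0 j1) = c j0 j1"
    by metis
  have Gg': "?G g'" using g' by blast
  have cost_g': "cost \<phi> (?S w g') = ?D w" for w
    unfolding costS[OF Gg'] D using g' by simp
  have c_le: "c j0 j1 \<le> cost \<phi> \<gamma>" if "\<gamma> \<in> couplings (m0 j0) (m1 j1)" for \<gamma> j0 j1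
    unfolding c_inf using that by (rule INF_lower)
  have c_fin: "c j0 j1 < \<top>" if "j0 \<in> {1..J0}" "j1 \<in> {1..J1}" for j0 j1
    using cost_finite[OF \<phi>, of "m0 j0" \<Omega> "m1 j1" "g' j0 j1"] g'[OF that] m0[OF that(1)] m1[OF that(2)] assms(4) by auto
  have D_le: "?D w \<le> cost \<phi> (?S w g)" if "?G g" for w g
    unfolding costS[OF that] D using that c_le by (intro sum_mono mult_left_mono) auto
  have opt: "\<gamma> \<in> opt_couplings \<phi> (m0 j0) (m1 j1) \<longleftrightarrow> \<gamma> \<in> couplings (m0 j0) (m1 j1) \<and> cost \<phi> \<gamma> = c j0 j1"
    if "j0 \<in> {1..J0}" "j1 \<in> {1..J1}" for \<gamma> j0 j1
    unfolding opt_couplings_def minimizers_iff using g'[OF that] c_le by (metis order_antisym)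
  have "(INF \<gamma>\<in>?X. cost \<phi> \<gamma>) = (INF w\<in>?Wc. ?D w)"
  proof (rule antisym)
    show "(INF \<gamma>\<in>?X. cost \<phi> \<gamma>) \<le> (INF w\<in>?Wc. ?D w)"
    proof (rule INF_greatest)
      fix w assume "w \<in> ?Wc"
      then show "(INF \<gamma>\<in>?X. cost \<phi> \<gamma>) \<le> ?D w"
        unfolding cost_g'[symmetric] by (intro INF_lower SX Gg')
    qed
    show "(INF w\<in>?Wc. ?D w) \<le> (INF \<gamma>\<in>?X. cost \<phi> \<gamma>)"
    proof (rule INF_greatest)
      fix \<gamma> assume "\<gamma> \<in> ?X"
      then obtain w g where wg: "w \<in> ?Wc" "?G g" "\<gamma> = ?S w g" using XS by blast
      show "(INF w\<in>?Wc. ?D w) \<le> cost \<phi> \<gamma>"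
        unfolding wg(3) by (rule order_trans[OF INF_lower[OF wg(1)] D_le[OF wg(2)]])
    qed
  qed
  then have "MW \<phi> \<Omega> A \<nu>0 \<nu>1 = W_dict \<phi> J0 J1 l0 l1 m0 m1"
    by (simp add: MW_def W_dict_def)
  moreover have "minimizers (cost \<phi>) ?X = {?S w g | w g. w \<in> minimizers ?D ?Wc \<and>
       (\<forall>j0\<in>{1..J0}. \<forall>j1\<in>{1..J1}. g j0 j1 \<in> opt_couplings \<phi> (m0 j0) (m1 j1))}" (is "?L = ?R")
  proof (intro set_eqI iffI)
    fix \<gamma> assume "\<gamma> \<in> ?L"
    then have \<gamma>: "\<gamma> \<in> ?X" "\<And>\<gamma>'. \<gamma>' \<in> ?X \<Longrightarrow> cost \<phi> \<gamma> \<le> cost \<phi> \<gamma>'" by (auto simp: minimizers_iff)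
    obtain w g where wg: "w \<in> ?Wc" "?G g" "\<gamma> = ?S w g" using XS[OF \<gamma>(1)] by blast
    have le: "cost \<phi> (?S w g) \<le> ?D w'" if "w' \<in> ?Wc" for w'
      using \<gamma>(2)[OF SX[OF that Gg']] unfolding cost_g' wg(3) .
    have "?D w \<le> ?D w'" if "w' \<in> ?Wc" for w'
      using D_le[OF wg(2)] le[OF that] by (rule order_trans)
    then have w_min: "w \<in> minimizers ?D ?Wc" using wg(1) by (simp add: minimizers_iff)
    have eq: "cost \<phi> (?S w g) = ?D w" using le[OF wg(1)] D_le[OF wg(2)] by (rule antisym)
    \<comment> \<open>Two finite sums that agree and whose terms are ordered agree term by term; finiteness of \<open>c\<close> permits cancellation.\<close>
    have wc: "ennreal (w j0 j1) * cost \<phi> (g j0 j1) = ennreal (w j0 j1) * c j0 j1"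
      if j: "j0 \<in> {1..J0}" "j1 \<in> {1..J1}" for j0 j1
    proof -
      let ?a = "\<lambda>p. ennreal (w (fst p) (snd p)) * c (fst p) (snd p)"
      let ?b = "\<lambda>p. ennreal (w (fst p) (snd p)) * cost \<phi> (g (fst p) (snd p))"
      have ab: "?a p \<le> ?b p" if "p \<in> ?I" for p
        using wg(2) that c_le by (intro mult_left_mono) auto
      have sum: "sum ?a ?I = sum ?b ?I"
        using eq unfolding costS[OF wg(2)] D by (simp add: sum.cartesian_product case_prod_beta')
      define r where "r = sum ?a (?I - {(j0, j1)})"
      have "?a p < \<top>" if "p \<in> ?I" for p
        using c_fin[of "fst p" "snd p"] that by (auto simp: ennreal_mult_less_top)
      then have "r < \<top>" unfolding r_def by simp
      then have r: "r \<noteq> \<top>" by simp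
      have "r + ?b (j0, j1) = ?b (j0, j1) + sum ?a (?I - {(j0, j1)})" by (simp add: r_def add.commute)
      also have "\<dots> \<le> ?b (j0, j1) + sum ?b (?I - {(j0, j1)})"
        using ab by (intro add_left_mono sum_mono) auto
      also have "\<dots> = r + ?a (j0, j1)"
        using sum j sum.remove[of ?I "(j0, j1)" ?a] sum.remove[of ?I "(j0, j1)" ?b]
        by (simp add: r_def add.commute)
      finally have "?b (j0, j1) \<le> ?a (j0, j1)"
        using r by (simp add: ennreal_add_left_cancel_le)
      then show ?thesis using ab[of "(j0, j1)"] j by simp
    qed
    \<comment> \<open>Couplings of weight zero do not affect the plan, so they may be replaced by optimal ones.\<close>
    define h where "h j0 j1 = (if w j0 j1 = 0 then g' j0 j1 else g j0 j1)" for j0 j1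
    have "h j0 j1 \<in> opt_couplings \<phi> (m0 j0) (m1 j1)" if j: "j0 \<in> {1..J0}" "j1 \<in> {1..J1}" for j0 j1
    proof (cases "w j0 j1 = 0")
      case True
      then show ?thesis using g'[OF j] by (simp add: opt[OF j] h_def)
    next
      case False
      then have "w j0 j1 > 0" using wg(1) j by (force simp: weight_couplings_def)
      then have "cost \<phi> (g j0 j1) = c j0 j1"
        using wc[OF j] by (simp add: ennreal_mult_cancel_left)
      then show ?thesis using False wg(2) j by (simp add: opt[OF j] h_def)
    qed
    moreover have "?S w g = ?S w h"
    proof (rule measure_eqI)
      fix E assume "E \<in> sets (?S w g)"
      then have E: "E \<in> sets ?N" by simp
      have Gh: "?G h" using wg(2) Gg' by (simp add: h_def)
      have em: "emeasure (?S w f) E = (\<Sum>p\<in>?I. ennreal (w (fst p) (snd p)) * emeasure (f (fst p) (snd p)) E)"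
        if "?G f" for f
      proof -
        have "sets (f j0 j1) = sets ?N" if "j0 \<in> {1..J0}" "j1 \<in> {1..J1}" for j0 j1
          using that \<open>?G f\<close> by (intro sets_coupling[of _ j0 j1]) blast+
        then show ?thesis
          using E by (subst emeasure_weighted_sum) (auto simp: case_prod_beta')
      qed
      show "emeasure (?S w g) E = emeasure (?S w h) E"
        unfolding em[OF wg(2)] em[OF Gh] by (intro sum.cong) (auto simp: h_def)
    qed simp
    ultimately show "\<gamma> \<in> ?R" using w_min wg(3) by blast
  next
    fix \<gamma> assume "\<gamma> \<in> ?R"
    then obtain w g where \<gamma>: "\<gamma> = ?S w g" and w: "w \<in> minimizers ?D ?Wc"
      and g: "\<forall>j0\<in>{1..J0}. \<forall>j1\<in>{1..J1}. g j0 j1 \<in> opt_couplings \<phi> (m0 j0) (m1 j1)" by blast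
    have Gg: "?G g" using g opt by blast
    have "cost \<phi> (?S w g) = ?D w"
      unfolding costS[OF Gg] D using g opt by (intro sum.cong refl) auto
    moreover have "?D w \<le> cost \<phi> \<gamma>'" if "\<gamma>' \<in> ?X" for \<gamma>'
    proof -
      obtain w' f where wf: "w' \<in> ?Wc" "?G f" "\<gamma>' = ?S w' f"
        using XS[OF \<open>\<gamma>' \<in> ?X\<close>] by blast
      have "?D w \<le> ?D w'" using w wf(1) by (simp add: minimizers_iff)
      also have "\<dots> \<le> cost \<phi> \<gamma>'" unfolding wf(3) by (rule D_le[OF wf(2)])
      finally show ?thesis .
    qed
    moreover have "\<gamma> \<in> ?X" unfolding \<gamma> using w Gg by (intro SX) (auto simp: minimizers_iff)
    ultimately show "\<gamma> \<in> ?L" by (simp add: minimizers_iff \<gamma>)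
  qed
  ultimately show ?thesis by blast
qed

end
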